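(* There exist a closed subset $X\subset\mathbb{R}$, a nonatomic Borel probability measure $\mu$ on $X$, and a continuous cost $C:X\times X\to[0,\infty)$, satisfying the finiteness assumption with $Y=X$ and $\nu=\mu$ (see context), for which the entropic minimisers $P_\varepsilon\in\Pi(\mu,\mu)$, $\varepsilon>0$, satisfy the following properties: (i) $P_\varepsilon\to P^\star$ in total variation as $\varepsilon\downarrow0$, for an optimal transport plan $P^\star\in\Pi(\mu,\mu)$ (for the cost $C$) with noncompact support $\Gamma:=\operatorname{supp}(P^\star)$; (ii) for some closed noncompact set $F\subset X\times X$, $$\inf_F I_\Gamma>0\qquad\text{but}\qquad \limsup_{\varepsilon\downarrow0}\varepsilon\log P_\varepsilon(F)>-\inf_F I_\Gamma .$$
   Context: For Polish spaces $X,Y$ and Borel probability measures $\mu$ on $X$, $\nu$ on $Y$, $\Pi(\mu,\nu)$ is the set of Borel probability measures on $X\times Y$ with first marginal $\mu$ and second marginal $\nu$. For probability measures $P,Q$ on a common measurable space, $\mathrm{KL}(P\|Q)=\int\log(dP/dQ)\,dP$ if $P\ll Q$ and $+\infty$ otherwise. Total variation distance is $\|P-Q\|_{\mathrm{TV}}=\sup_A|P(A)-Q(A)|$. Finiteness assumption on $(X,Y,\mu,\nu,C)$: there is $P_0\in\Pi(\mu,\nu)$ with $\int C\,dP_0<\infty$ and $\mathrm{KL}(P_0\|\mu\otimes\nu)<\infty$. Under it, for every $\varepsilon>0$ the functional $P\mapsto\int C\,dP+\varepsilon\,\mathrm{KL}(P\|\mu\otimes\nu)$ has a unique minimiser $P_\varepsilon$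 over $\Pi(\mu,\nu)$, called the entropic minimiser. An optimal transport plan is a minimiser of $P\mapsto\int C\,dP$ over $\Pi(\mu,\nu)$. For a set $\Gamma\subset X\times Y$ (the support of a limit plan), the rate $I_\Gamma:X\times Y\to[0,\infty]$ is $$I_\Gamma(x,y):=\sup_{k\ge2}\ \sup_{(x_i,y_i)_{i=2}^k\in\Gamma^{k-1}}\ \sup_{\sigma\in\Sigma(k)}\Big[\sum_{i=1}^kC(x_i,y_i)-\sum_{i=1}^kC(x_i,y_{\sigma(i)})\Big],\qquad (x_1,y_1)=(x,y),$$ where $\Sigma(k)$ is the set of permutations of $\{1,\dots,k\}$. Here $Y=X$, $\nu=\mu$. Convention: $\log0=-\infty$. *)

theory Defs
  imports "HOL-Probability.Probability"
begin

text \<open>A Borel probability measure on a Borel subset \<open>X\<close> of a topological space is a probability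
  measure whose \<open>\<sigma>\<close>-algebra is that of \<open>restrict_space borel X\<close>; in particular its space is \<open>X\<close>.\<close>

definition borel_prob_on :: "'a::topological_space set \<Rightarrow> 'a measure \<Rightarrow> bool" where
  "borel_prob_on X \<mu> \<longleftrightarrow> prob_space \<mu> \<and> sets \<mu> = sets (restrict_space borel X)"

definition nonatomic :: "'a measure \<Rightarrow> bool" where
  "nonatomic \<mu> \<longleftrightarrow>
     (\<forall>A\<in>sets \<mu>. 0 < emeasure \<mu> A \<longrightarrow>
        (\<exists>B\<in>sets \<mu>. B \<subseteq> A \<and> 0 < emeasure \<mu> B \<and> emeasure \<mu> B < emeasure \<mu> A))"

text \<open>For Borel measures on second countable spaces, the product \<open>\<sigma>\<close>-algebra used here is the
  Borel \<open>\<sigma>\<close>-algebra of the product space.\<close>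

definition couplings :: "'a measure \<Rightarrow> 'b measure \<Rightarrow> ('a \<times> 'b) measure set" where
  "couplings \<mu> \<nu> =
     {P. prob_space P \<and> sets P = sets (\<mu> \<Otimes>\<^sub>M \<nu>) \<and> distr P \<mu> fst = \<mu> \<and> distr P \<nu> snd = \<nu>}"

text \<open>\<open>KL P Q\<close> is the divergence of \<open>P\<close> from \<open>Q\<close>; note that the library's real-valued
  \<open>KL_divergence\<close> takes the reference measure \<open>Q\<close> first. For probability measures the negative part
  of \<open>log (dP/dQ)\<close> is always \<open>P\<close>-integrable, so if \<open>P\<close> is absolutely continuous with respect to \<open>Q\<close>
  and \<open>log (dP/dQ)\<close> is not integrable, then its integral is \<open>\<infinity>\<close>.\<close>

definition KL :: "'a measure \<Rightarrow> 'a measure \<Rightarrow> ereal" where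
  "KL P Q =
     (if absolutely_continuous Q P \<and> integrable P (entropy_density (exp 1) Q P)
      then ereal (KL_divergence (exp 1) Q P) else \<infinity>)"

definition tv_dist :: "'a measure \<Rightarrow> 'a measure \<Rightarrow> real" where
  "tv_dist P Q = (SUP A\<in>sets P. \<bar>measure P A - measure Q A\<bar>)"

text \<open>Costs are nonnegative on \<open>space P\<close> throughout, so \<open>ennreal\<close> does not truncate.\<close>

definition transport_cost :: "('a \<Rightarrow> real) \<Rightarrow> 'a measure \<Rightarrow> ennreal" where
  "transport_cost C P = (\<integral>\<^sup>+ z. ennreal (C z) \<partial>P)"

definition optimal_plan ::
  "'a measure \<Rightarrow> 'b measure \<Rightarrow> ('a \<times> 'b \<Rightarrow> real) \<Rightarrow> ('a \<times> 'b) measure \<Rightarrow> bool" where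
  "optimal_plan \<mu> \<nu> C P \<longleftrightarrow> is_arg_min (transport_cost C) (\<lambda>Q. Q \<in> couplings \<mu> \<nu>) P"

definition finiteness_assumption ::
  "'a measure \<Rightarrow> 'b measure \<Rightarrow> ('a \<times> 'b \<Rightarrow> real) \<Rightarrow> bool" where
  "finiteness_assumption \<mu> \<nu> C \<longleftrightarrow>
     (\<exists>P\<in>couplings \<mu> \<nu>. transport_cost C P < \<infinity> \<and> KL P (\<mu> \<Otimes>\<^sub>M \<nu>) < \<infinity>)"

definition entropic_cost ::
  "'a measure \<Rightarrow> 'b measure \<Rightarrow> ('a \<times> 'b \<Rightarrow> real) \<Rightarrow> real \<Rightarrow> ('a \<times> 'b) measure \<Rightarrow> ereal" where
  "entropic_cost \<mu> \<nu> C \<epsilon> P =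
     enn2ereal (transport_cost C P) + ereal \<epsilon> * KL P (\<mu> \<Otimes>\<^sub>M \<nu>)"

text \<open>\<open>P\<close> is the unique minimiser of the entropic cost.\<close>

definition entropic_minimiser ::
  "'a measure \<Rightarrow> 'b measure \<Rightarrow> ('a \<times> 'b \<Rightarrow> real) \<Rightarrow> real \<Rightarrow> ('a \<times> 'b) measure \<Rightarrow> bool" where
  "entropic_minimiser \<mu> \<nu> C \<epsilon> P \<longleftrightarrow>
     (\<forall>Q. is_arg_min (entropic_cost \<mu> \<nu> C \<epsilon>) (\<lambda>R. R \<in> couplings \<mu> \<nu>) Q \<longleftrightarrow> Q = P)"

text \<open>The support relative to the subspace \<open>space P\<close>: the points all of whose neighbourhoods have
  positive measure.\<close>

definition measure_support :: "'a::topological_space measure \<Rightarrow> 'a set" where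
  "measure_support P =
     {z \<in> space P. \<forall>U. open U \<longrightarrow> z \<in> U \<longrightarrow> 0 < emeasure P (U \<inter> space P)}"

text \<open>In the following, \<open>z i\<close> is the pair \<open>(x\<^sub>i, y\<^sub>i)\<close>; only its values for \<open>1 \<le> i \<le> k\<close>
  matter. Taking \<open>\<sigma> = id\<close> shows that the rate is nonnegative if \<open>\<Gamma>\<close> is nonempty.\<close>

definition rate :: "('a \<times> 'b \<Rightarrow> real) \<Rightarrow> ('a \<times> 'b) set \<Rightarrow> 'a \<times> 'b \<Rightarrow> ereal" where
  "rate C \<Gamma> p =
     (SUP (k, z, \<sigma>) \<in> {(k::nat, z::nat \<Rightarrow> 'a \<times> 'b, \<sigma>::nat \<Rightarrow> nat).
          2 \<le> k \<and> z 1 = p \<and> (\<forall>i\<in>{2..k}. z i \<in> \<Gamma>) \<and> \<sigma> permutes {1..k}}.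
        ereal ((\<Sum>i=1..k. C (z i)) - (\<Sum>i=1..k. C (fst (z i), snd (z (\<sigma> i))))))"

definition elog :: "real \<Rightarrow> ereal" where
  "elog p = (if p = 0 then - \<infinity> else ereal (ln p))"

end

(* The space is a disjoint union of unit intervals, grouped into regions n = 0, 1, 2, ... of weight
   2^-(n+1). The intervals of region n form an N x N chessboard of equal weights, with N = side n huge.
   Two intervals of the same region have cost 0 if they share a row or a column and cost 1 otherwise;
   intervals of different regions have cost 4. The zero-cost pairs form a connected bipartite graph in
   each region, so the rate is at least 1 on the cost-1 pairs F; but they are only a fraction
   r of about 2/N of all pairs. When exp(-1/eps) is about r, the few zero-cost pairs and the many cost-1
   pairs of region n receive comparable mass, so P_eps(F) is at least of the order of the weight
   2^-(n+1), which is much larger than exp(-1/eps).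
   By symmetry the Schroedinger potentials are constant on regions and, as the cost between different
   regions is constant, they solve decoupled quadratic equations once the scalar S (the potential's
   mean) is known; S exists by the intermediate value theorem. *)
theory Submission
  imports Defs
begin

section \<open>Entropic minimisers of Gibbs form\<close>

text \<open>In any fixed region the cost-1 pairs have mass at most
  \<open>exp (- 1 / \<epsilon>) / r\<close>, in accordance with a rate of 1. However, the true
  prefactor is about the weight of the region divided by \<open>r\<close>, and it is unbounded over
  the regions. Noncompactness lets the offending region move to infinity as \<epsilon> decreases:
  every fixed region still converges to its zero-cost pairs and the offending one has vanishing
  weight, so convergence in total variation survives. The sides are chosen for the logarithmic
  scale. When \<open>exp (- 1 / \<epsilon>) = (1 / 16) ^ (n + 2)\<close>, a mass of order
  \<open>(1 / 2) ^ n\<close> is only about the fourth root of that factor, so \<epsilon> times its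
  logarithm is near -1/4 instead of at most -1. Minimality needs no existence theory: a coupling
  with density \<open>exp (\<phi> x + \<psi> y - C (x, y) / \<epsilon>)\<close> and bounded
  potentials is automatically the unique minimiser. What has to be produced is a bounded solution of
  the marginal equations for infinitely many regions at once.\<close>

lemma density_in_couplings:
  assumes "prob_space \<mu>" "prob_space \<nu>" and [measurable]: "\<rho> \<in> borel_measurable (\<mu> \<Otimes>\<^sub>M \<nu>)"
    and row: "AE x in \<mu>. (\<integral>\<^sup>+ y. \<rho> (x, y) \<partial>\<nu>) = 1"
    and col: "AE y in \<nu>. (\<integral>\<^sup>+ x. \<rho> (x, y) \<partial>\<mu>) = 1"
  shows "density (\<mu> \<Otimes>\<^sub>M \<nu>) \<rho> \<in> couplings \<mu> \<nu>"
proof -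
  interpret M: prob_space \<mu> by fact
  interpret N: prob_space \<nu> by fact
  interpret pair_prob_space \<mu> \<nu> ..
  have fst: "distr (density (\<mu> \<Otimes>\<^sub>M \<nu>) \<rho>) \<mu> fst = \<mu>"
  proof (rule measure_eqI)
    fix A assume "A \<in> sets (distr (density (\<mu> \<Otimes>\<^sub>M \<nu>) \<rho>) \<mu> fst)"
    then have [measurable]: "A \<in> sets \<mu>" by simp
    have "emeasure (distr (density (\<mu> \<Otimes>\<^sub>M \<nu>) \<rho>) \<mu> fst) A
        = (\<integral>\<^sup>+ z. \<rho> z * indicator A (fst z) \<partial>(\<mu> \<Otimes>\<^sub>M \<nu>))"
      by (subst nn_integral_indicator[symmetric], simp, subst nn_integral_distr)
        (simp_all add: nn_integral_density)
    also have "\<dots> = (\<integral>\<^sup>+ x. (\<integral>\<^sup>+ y. \<rho> (x, y) * indicator A x \<partial>\<nu>) \<partial>\<mu>)"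
      by (subst N.nn_integral_fst[symmetric]) simp_all
    also have "\<dots> = (\<integral>\<^sup>+ x. indicator A x \<partial>\<mu>)"
    proof (rule nn_integral_cong_AE, use row AE_space in eventually_elim)
      fix x assume "x \<in> space \<mu>" and r: "(\<integral>\<^sup>+ y. \<rho> (x, y) \<partial>\<nu>) = 1"
      then have [measurable]: "(\<lambda>y. \<rho> (x, y)) \<in> borel_measurable \<nu>" by simp
      show "(\<integral>\<^sup>+ y. \<rho> (x, y) * indicator A x \<partial>\<nu>) = indicator A x"
        by (subst nn_integral_multc) (simp_all add: r)
    qed
    finally show "emeasure (distr (density (\<mu> \<Otimes>\<^sub>M \<nu>) \<rho>) \<mu> fst) A = emeasure \<mu> A" by simp
  qed simp
  have snd: "distr (density (\<mu> \<Otimes>\<^sub>M \<nu>) \<rho>) \<nu> snd = \<nu>"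
  proof (rule measure_eqI)
    fix A assume "A \<in> sets (distr (density (\<mu> \<Otimes>\<^sub>M \<nu>) \<rho>) \<nu> snd)"
    then have [measurable]: "A \<in> sets \<nu>" by simp
    have "emeasure (distr (density (\<mu> \<Otimes>\<^sub>M \<nu>) \<rho>) \<nu> snd) A
        = (\<integral>\<^sup>+ z. \<rho> z * indicator A (snd z) \<partial>(\<mu> \<Otimes>\<^sub>M \<nu>))"
      by (subst nn_integral_indicator[symmetric], simp, subst nn_integral_distr)
        (simp_all add: nn_integral_density)
    also have "\<dots> = (\<integral>\<^sup>+ y. (\<integral>\<^sup>+ x. \<rho> (x, y) * indicator A y \<partial>\<mu>) \<partial>\<nu>)"
      by (subst nn_integral_snd[symmetric]) simp_all
    also have "\<dots> = (\<integral>\<^sup>+ y. indicator A y \<partial>\<nu>)"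
    proof (rule nn_integral_cong_AE, use col AE_space in eventually_elim)
      fix y assume "y \<in> space \<nu>" and r: "(\<integral>\<^sup>+ x. \<rho> (x, y) \<partial>\<mu>) = 1"
      then have [measurable]: "(\<lambda>x. \<rho> (x, y)) \<in> borel_measurable \<mu>" by simp
      show "(\<integral>\<^sup>+ x. \<rho> (x, y) * indicator A y \<partial>\<mu>) = indicator A y"
        by (subst nn_integral_multc) (simp_all add: r)
    qed
    finally show "emeasure (distr (density (\<mu> \<Otimes>\<^sub>M \<nu>) \<rho>) \<nu> snd) A = emeasure \<nu> A" by simp
  qed simp
  have "prob_space (density (\<mu> \<Otimes>\<^sub>M \<nu>) \<rho>)"
    by (rule prob_space_distrD[of fst _ \<mu>]) (simp_all add: fst M.prob_space_axioms)
  with fst snd show ?thesis by (simp add: couplings_def)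
qed

text \<open>Chain rule: KL of \<open>Q\<close> relative to \<open>R\<close> is KL of
  \<open>Q\<close> relative to \<open>P\<close> plus the integral of \<open>h\<close> over
  \<open>Q\<close>, and the first summand is positive unless \<open>Q = P\<close>. The bound on
  \<open>h\<close> makes it integrable under every \<open>Q\<close>, so nothing of the form infinity
  minus infinity occurs.\<close>

lemma
  fixes h :: "'a \<Rightarrow> real"
  assumes "prob_space R" and [measurable]: "h \<in> borel_measurable R"
    and bnd: "\<And>x. x \<in> space R \<Longrightarrow> \<bar>h x\<bar> \<le> B"
    and P_def: "P = density R (\<lambda>x. ennreal (exp (h x)))" and "prob_space P"
  shows KL_tilted: "KL P R = ereal (\<integral>x. h x \<partial>P)"
    and KL_gt_tilted: "\<And>Q. prob_space Q \<Longrightarrow> sets Q = sets R \<Longrightarrow> Q \<noteq> P \<Longrightarrow>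
       ereal (\<integral>x. h x \<partial>Q) < KL Q R"
proof -
  interpret R: prob_space R by fact
  interpret P: prob_space P by fact
  interpret IP: information_space P "exp 1" by standard simp
  have sP[measurable_cong]: "sets P = sets R" by (simp add: P_def)
  have log1: "log (exp 1) x = ln x" for x by (simp add: log_def)
  have acPR: "absolutely_continuous R P"
    unfolding P_def by (rule absolutely_continuousI_density) simp
  have "AE x in R. ennreal (exp (h x)) = RN_deriv R P x"
    by (rule R.RN_deriv_unique) (simp_all add: P_def)
  then have "AE x in P. ennreal (exp (h x)) = RN_deriv R P x"
    by (rule absolutely_continuous_AE[OF sP acPR])
  then have eP: "AE x in P. entropy_density (exp 1) R P x = h x"
  proof eventually_elim
    fix x assume "ennreal (exp (h x)) = RN_deriv R P x"
    from this[symmetric] show "entropy_density (exp 1) R P x = h x"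
      by (simp add: entropy_density_def log1)
  qed
  have int_h: "integrable Q h" if "prob_space Q" and [measurable_cong]: "sets Q = sets R" for Q
  proof -
    interpret Q: prob_space Q by fact
    show ?thesis
      by (rule Q.integrable_const_bound[of _ B]) (use bnd sets_eq_imp_space_eq[OF that(2)] in auto)
  qed
  have me[measurable]: "entropy_density (exp 1) R Q \<in> borel_measurable R" for Q
    by (rule measurable_entropy_density) 
  have iP: "integrable P (entropy_density (exp 1) R P)"
    using int_h[OF P.prob_space_axioms sP] eP by (subst integrable_cong_AE[where g=h]) auto
  have "KL_divergence (exp 1) R P = (\<integral>x. h x \<partial>P)"
    unfolding KL_divergence_def by (rule integral_cong_AE) (use eP in auto)
  with iP acPR show "KL P R = ereal (\<integral>x. h x \<partial>P)" by (simp add: KL_def)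
  fix Q assume "prob_space Q" and sQ[measurable_cong]: "sets Q = sets R" and neq: "Q \<noteq> P"
  interpret Q: prob_space Q by fact
  show "ereal (\<integral>x. h x \<partial>Q) < KL Q R"
  proof (cases "absolutely_continuous R Q \<and> integrable Q (entropy_density (exp 1) R Q)")
    case True
    then have ac: "absolutely_continuous R Q" and iQ: "integrable Q (entropy_density (exp 1) R Q)"
      by auto
    have fm: "finite_measure Q" by unfold_locales
    from R.real_RN_deriv[OF fm ac sQ] obtain D where D[measurable]: "D \<in> borel_measurable R"
      and RN: "AE x in R. RN_deriv R Q x = ennreal (D x)"
      and Dpos: "AE x in Q. 0 < D x" and Dnn: "\<And>x. 0 \<le> D x" by auto
    have "Q = density R (RN_deriv R Q)" using ac sQ by (rule R.density_RN_deriv[symmetric])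
    also have "\<dots> = density R D" using RN by (intro density_cong) auto
    finally have QD: "Q = density R (\<lambda>x. ennreal (D x))" .
    \<comment> \<open>The density of \<open>Q\<close> with respect to \<open>P\<close>; its
      logarithm is the log-density relative to \<open>R\<close> minus \<open>h\<close>.\<close>
    define D' where "D' x = D x * exp (- h x)" for x
    have [measurable]: "D' \<in> borel_measurable R" by (simp add: D'_def[abs_def])
    have QP: "Q = density P (\<lambda>x. ennreal (D' x))"
      unfolding P_def QD
      by (subst density_density_eq, simp, simp)
        (auto simp: D'_def ennreal_mult[symmetric] Dnn exp_minus intro!: density_cong)
    have "AE x in Q. RN_deriv R Q x = ennreal (D x)"
      by (rule absolutely_continuous_AE[OF sQ ac RN])
    then have eQ: "AE x in Q. entropy_density (exp 1) R Q x = ln (D' x) + h x"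
      using Dpos
    proof eventually_elim
      fix x assume "RN_deriv R Q x = ennreal (D x)" "0 < D x"
      then show "entropy_density (exp 1) R Q x = ln (D' x) + h x"
        by (simp add: entropy_density_def log1 D'_def ln_mult)
    qed
    have "integrable Q (\<lambda>x. entropy_density (exp 1) R Q x - h x)"
      using iQ int_h[OF Q.prob_space_axioms sQ] by auto
    then have il: "integrable Q (\<lambda>x. ln (D' x))"
      by (rule integrable_cong_AE[THEN iffD1, rotated -1]) (use eQ in auto)
    have i2: "integrable P (\<lambda>x. D' x * log (exp 1) (D' x))"
      using il unfolding QP log1
      by (subst (asm) integrable_real_density) (auto simp: D'_def Dnn)
    have "0 < KL_divergence (exp 1) P (density P D')"
    proof (rule IP.KL_gt_0)
      show "prob_space (density P D')" "density P D' \<noteq> P"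
        using neq Q.prob_space_axioms by (simp_all add: QP[symmetric])
      show "AE x in P. 0 \<le> D' x" by (simp add: D'_def Dnn)
    qed (use i2 in simp_all)
    also have "KL_divergence (exp 1) P (density P D') = (\<integral>x. D' x * ln (D' x) \<partial>P)"
      by (subst P.KL_density) (auto simp: D'_def Dnn log1)
    also have "\<dots> = (\<integral>x. ln (D' x) \<partial>Q)"
      unfolding QP by (subst integral_real_density) (auto simp: D'_def Dnn)
    finally have pos: "0 < (\<integral>x. ln (D' x) \<partial>Q)" .
    have "KL_divergence (exp 1) R Q = (\<integral>x. ln (D' x) + h x \<partial>Q)"
      unfolding KL_divergence_def by (rule integral_cong_AE) (use eQ in auto)
    also have "\<dots> = (\<integral>x. ln (D' x) \<partial>Q) + (\<integral>x. h x \<partial>Q)"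
      using il int_h[OF Q.prob_space_axioms sQ] by simp
    finally show ?thesis using True pos by (simp add: KL_def)
  next
    case False
    then show ?thesis by (auto simp: KL_def)
  qed
qed

lemma integrable_bounded_prob:
  fixes f :: "'a \<Rightarrow> real"
  assumes "prob_space M" "f \<in> borel_measurable M" "\<And>x. x \<in> space M \<Longrightarrow> \<bar>f x\<bar> \<le> B"
  shows "integrable M f"
proof -
  interpret prob_space M by fact
  show ?thesis by (rule integrable_const_bound[of _ B]) (use assms in auto)
qed

text \<open>On couplings, the integral of \<open>C\<close> plus \<epsilon> times that of the
  exponent \<open>h\<close> depends only on the marginals. By the chain rule for the tilt, the
  entropic cost of \<open>Q\<close> is therefore a constant plus \<epsilon> times KL of
  \<open>Q\<close> relative to \<open>P\<close>, which vanishes only at \<open>P\<close>.\<close>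

lemma
  fixes C :: "'a \<times> 'b \<Rightarrow> real"
  assumes "prob_space \<mu>" "prob_space \<nu>" and \<epsilon>: "0 < \<epsilon>"
    and [measurable]: "C \<in> borel_measurable (\<mu> \<Otimes>\<^sub>M \<nu>)" "\<phi> \<in> borel_measurable \<mu>" "\<psi> \<in> borel_measurable \<nu>"
    and Cnn: "\<And>z. z \<in> space \<mu> \<times> space \<nu> \<Longrightarrow> 0 \<le> C z"
    and Cb: "\<And>z. z \<in> space \<mu> \<times> space \<nu> \<Longrightarrow> C z \<le> B"
    and \<phi>b: "\<And>x. x \<in> space \<mu> \<Longrightarrow> \<bar>\<phi> x\<bar> \<le> B1" and \<psi>b: "\<And>y. y \<in> space \<nu> \<Longrightarrow> \<bar>\<psi> y\<bar> \<le> B2"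
    and P_def: "P = density (\<mu> \<Otimes>\<^sub>M \<nu>) (\<lambda>(x, y). ennreal (exp (\<phi> x + \<psi> y - C (x, y) / \<epsilon>)))"
    and P: "P \<in> couplings \<mu> \<nu>"
  shows entropic_minimiser_density: "entropic_minimiser \<mu> \<nu> C \<epsilon> P"
    and finiteness_assumption_density: "finiteness_assumption \<mu> \<nu> C"
proof -
  interpret M: prob_space \<mu> by fact
  interpret N: prob_space \<nu> by fact
  interpret pair_prob_space \<mu> \<nu> ..
  define h where "h = (\<lambda>(x, y). \<phi> x + \<psi> y - C (x, y) / \<epsilon>)"
  have hm[measurable]: "h \<in> borel_measurable (\<mu> \<Otimes>\<^sub>M \<nu>)" by (simp add: h_def)
  have P': "P = density (\<mu> \<Otimes>\<^sub>M \<nu>) (\<lambda>z. ennreal (exp (h z)))"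
    unfolding P_def h_def by (rule arg_cong[where f="density _"]) auto
  have hb: "\<bar>h z\<bar> \<le> B1 + B2 + B / \<epsilon>" if z0: "z \<in> space (\<mu> \<Otimes>\<^sub>M \<nu>)" for z
  proof -
    obtain x y where z: "z = (x, y)" "x \<in> space \<mu>" "y \<in> space \<nu>"
      using z0 by (cases z) (auto simp: space_pair_measure)
    have "0 \<le> C z / \<epsilon>" "C z / \<epsilon> \<le> B / \<epsilon>"
      using Cb[of z] Cnn[of z] z \<epsilon> by (auto simp: divide_right_mono)
    moreover have "h z = \<phi> x + \<psi> y - C z / \<epsilon>" using z by (simp add: h_def)
    ultimately show ?thesis using \<phi>b[OF z(2)] \<psi>b[OF z(3)] by linarith
  qed
  have cost: "transport_cost C Q = ennreal (\<integral>z. C z \<partial>Q)" and cost_nn: "0 \<le> (\<integral>z. C z \<partial>Q)"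
    and int_h: "(\<integral>z. C z \<partial>Q) + \<epsilon> * (\<integral>z. h z \<partial>Q) = \<epsilon> * ((\<integral>x. \<phi> x \<partial>\<mu>) + (\<integral>y. \<psi> y \<partial>\<nu>))"
    if "Q \<in> couplings \<mu> \<nu>" for Q
  proof -
    have Q: "prob_space Q" and s[measurable_cong]: "sets Q = sets (\<mu> \<Otimes>\<^sub>M \<nu>)"
      and f: "distr Q \<mu> fst = \<mu>" "distr Q \<nu> snd = \<nu>"
      using that by (auto simp: couplings_def)
    have sp: "space Q = space \<mu> \<times> space \<nu>" using sets_eq_imp_space_eq[OF s] by (simp add: space_pair_measure)
    have iC: "integrable Q C"
      by (rule integrable_bounded_prob[OF Q, of _ B]) (use Cb Cnn sp in auto)
    show "transport_cost C Q = ennreal (\<integral>z. C z \<partial>Q)"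
      unfolding transport_cost_def using iC Cnn sp by (intro nn_integral_eq_integral) auto
    show "0 \<le> (\<integral>z. C z \<partial>Q)" by (rule integral_nonneg_AE) (use Cnn sp in auto)
    have i1: "integrable Q (\<lambda>z. \<phi> (fst z))"
      by (rule integrable_bounded_prob[OF Q, of _ B1]) (use \<phi>b sp in auto)
    have i2: "integrable Q (\<lambda>z. \<psi> (snd z))"
      by (rule integrable_bounded_prob[OF Q, of _ B2]) (use \<psi>b sp in auto)
    have e1: "(\<integral>z. \<phi> (fst z) \<partial>Q) = (\<integral>x. \<phi> x \<partial>\<mu>)"
      using integral_distr[of fst Q \<mu> \<phi>] f(1) by simp
    have e2: "(\<integral>z. \<psi> (snd z) \<partial>Q) = (\<integral>x. \<psi> x \<partial>\<nu>)"
      using integral_distr[of snd Q \<nu> \<psi>] f(2) by simp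
    have "(\<integral>z. h z \<partial>Q) = (\<integral>z. \<phi> (fst z) + \<psi> (snd z) - C z / \<epsilon> \<partial>Q)"
      by (simp add: h_def case_prod_beta)
    also have "\<dots> = (\<integral>x. \<phi> x \<partial>\<mu>) + (\<integral>y. \<psi> y \<partial>\<nu>) - (\<integral>z. C z \<partial>Q) / \<epsilon>"
      using i1 i2 iC by (simp add: e1 e2)
    finally have hQ: "(\<integral>z. h z \<partial>Q) = (\<integral>x. \<phi> x \<partial>\<mu>) + (\<integral>y. \<psi> y \<partial>\<nu>) - (\<integral>z. C z \<partial>Q) / \<epsilon>" .
    show "(\<integral>z. C z \<partial>Q) + \<epsilon> * (\<integral>z. h z \<partial>Q) = \<epsilon> * ((\<integral>x. \<phi> x \<partial>\<mu>) + (\<integral>y. \<psi> y \<partial>\<nu>))"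
      unfolding hQ using \<epsilon> by (simp add: field_simps)
  qed
  have prP: "prob_space P" using P by (simp add: couplings_def)
  note tilt = KL_tilted[OF prob_space_axioms hm hb P' prP]
  note tilt_gt = KL_gt_tilted[OF prob_space_axioms hm hb P' prP]
  define c where "c = \<epsilon> * ((\<integral>x. \<phi> x \<partial>\<mu>) + (\<integral>y. \<psi> y \<partial>\<nu>))"
  have cP: "entropic_cost \<mu> \<nu> C \<epsilon> P = ereal c"
    using int_h[OF P] cost_nn[OF P]
    by (simp add: entropic_cost_def tilt cost[OF P] c_def enn2ereal_ennreal)
  have cQ: "ereal c < entropic_cost \<mu> \<nu> C \<epsilon> Q" if Q: "Q \<in> couplings \<mu> \<nu>" "Q \<noteq> P" for Q
  proof -
    have "ereal (\<integral>z. h z \<partial>Q) < KL Q (\<mu> \<Otimes>\<^sub>M \<nu>)"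
      using Q by (intro tilt_gt) (auto simp: couplings_def)
    then show ?thesis
      using int_h[OF Q(1)] cost_nn[OF Q(1)] \<epsilon>
      by (cases "KL Q (\<mu> \<Otimes>\<^sub>M \<nu>)")
        (auto simp: entropic_cost_def cost[OF Q(1)] c_def enn2ereal_ennreal simp flip: int_h[OF Q(1)])
  qed
  show "entropic_minimiser \<mu> \<nu> C \<epsilon> P"
    unfolding entropic_minimiser_def is_arg_min_def
  proof (intro allI iffI conjI)
    fix Q assume *: "Q \<in> couplings \<mu> \<nu> \<and> \<not> (\<exists>y. y \<in> couplings \<mu> \<nu> \<and> entropic_cost \<mu> \<nu> C \<epsilon> y < entropic_cost \<mu> \<nu> C \<epsilon> Q)"
    show "Q = P"
      using * cQ[of Q] P cP by metis
  next
    fix Q assume [simp]: "Q = P"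
    show "Q \<in> couplings \<mu> \<nu>" using P by simp
    show "\<not> (\<exists>y. y \<in> couplings \<mu> \<nu> \<and> entropic_cost \<mu> \<nu> C \<epsilon> y < entropic_cost \<mu> \<nu> C \<epsilon> Q)"
      using cQ cP by (metis \<open>Q = P\<close> less_asym less_irrefl)
  qed
  show "finiteness_assumption \<mu> \<nu> C"
    unfolding finiteness_assumption_def using P cost[OF P] tilt by (intro bexI[of _ P]) auto
qed

section \<open>The equation for the potential\<close>

text \<open>For a prescribed \<open>s\<close> in place of \<open>S\<close> the equations decouple
  into quadratics for \<open>u = w n * v n\<close>. What remains is a scalar fixed point of
  \<open>s \<mapsto> \<Sum>n. u n s\<close>. The bound \<open>u \<le> sqrt (w n) / sqrt d\<close> is
  uniform in \<open>s\<close> and summable, which gives continuity by the Weierstrass test and keeps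
  the sum bounded.\<close>

lemma quadratic_mean_field_solution:
  fixes a w :: "nat \<Rightarrow> real"
  assumes w: "\<And>n. 0 < w n" and sw: "summable (\<lambda>n. sqrt (w n))"
    and d: "0 < d" "\<And>n. d \<le> a n" and \<kappa>: "0 < \<kappa>"
  obtains v S where "0 < S" "\<And>n. 0 < v n" "(\<lambda>n. w n * v n) sums S"
    "\<And>n. v n * (a n * w n * v n + \<kappa> * S) = 1"
proof -
  have a: "0 < a n" for n using d(1) d(2)[of n] by linarith
  \<comment> \<open>The positive root of
    \<open>a n * u\<^sup>2 + \<kappa> * s * u = w n\<close>.\<close>
  define u where "u n s = (sqrt ((\<kappa> * s)\<^sup>2 + 4 * a n * w n) - \<kappa> * s) / (2 * a n)" for n s
  have u_pos: "0 < u n s" and u_eq: "u n s * (a n * u n s + \<kappa> * s) = w n"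
    and u_le: "u n s \<le> sqrt (w n) / sqrt d" if s: "0 \<le> s" for n s
  proof -
    define q where "q = sqrt ((\<kappa> * s)\<^sup>2 + 4 * a n * w n)"
    have q2: "q\<^sup>2 = (\<kappa> * s)\<^sup>2 + 4 * a n * w n"
      unfolding q_def using a[of n] w[of n] by (simp add: add_nonneg_pos less_imp_le)
    have "\<kappa> * s < q" unfolding q_def
      by (rule real_less_rsqrt) (use a[of n] w[of n] in simp)
    then show pos: "0 < u n s" using a[of n] by (simp add: u_def q_def)
    have uq: "u n s = (q - \<kappa> * s) / (2 * a n)" by (simp add: u_def q_def)
    have "u n s * (a n * u n s + \<kappa> * s) = (q\<^sup>2 - (\<kappa> * s)\<^sup>2) / (4 * a n)"
      unfolding uq using a[of n] by (simp add: field_simps power2_eq_square)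
    then show eq: "u n s * (a n * u n s + \<kappa> * s) = w n" using a[of n] by (simp add: q2)
    have "d * (u n s)\<^sup>2 \<le> a n * (u n s)\<^sup>2" using d(2)[of n] by (simp add: mult_right_mono)
    also have "\<dots> \<le> u n s * (a n * u n s + \<kappa> * s)"
      using pos s \<kappa> by (simp add: algebra_simps power2_eq_square)
    finally have "(u n s)\<^sup>2 \<le> w n / d" using d(1) eq by (simp add: field_simps)
    then show "u n s \<le> sqrt (w n) / sqrt d"
      by (metis real_le_rsqrt real_sqrt_divide)
  qed
  define M where "M n = sqrt (w n) / sqrt d" for n
  have sM: "summable M" unfolding M_def using sw by (rule summable_divide)
  have su: "summable (\<lambda>n. u n s)" if "0 \<le> s" for s
    by (rule summable_comparison_test'[OF sM, of 0])
      (use u_pos[OF that] u_le[OF that] in \<open>auto simp: M_def less_imp_le abs_of_pos\<close>)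
  define G where "G s = (\<Sum>n. u n s)" for s
  \<comment> \<open>Since \<open>b\<close> sums the majorants, it bounds \<open>G\<close> at every
    nonnegative argument. So \<open>G s - s\<close> is positive at \<open>0\<close> and nonpositive
    at \<open>b\<close>.\<close>
  define b where "b = suminf M"
  have "0 \<le> b" unfolding b_def by (rule suminf_nonneg[OF sM]) (use w d in \<open>auto simp: M_def less_imp_le\<close>)
  have "uniform_limit {0..b} (\<lambda>n s. \<Sum>i<n. u i s) G sequentially"
    unfolding G_def[abs_def]
    by (rule Weierstrass_m_test[OF _ sM])
      (use u_pos u_le in \<open>auto simp: M_def less_imp_le abs_of_pos\<close>)
  then have "continuous_on {0..b} G"
    by (rule uniform_limit_theorem[rotated])
      (auto intro!: always_eventually continuous_intros simp: u_def a[THEN less_imp_neq, symmetric])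
  then have cont: "continuous_on {0..b} (\<lambda>s. G s - s)" by (intro continuous_intros)
  have "G b \<le> b"
    unfolding G_def b_def[symmetric] by (subst (2) b_def, rule suminf_le[OF _ su sM])
      (use u_le \<open>0 \<le> b\<close> in \<open>auto simp: M_def\<close>)
  have Gpos: "0 < G s" if "0 \<le> s" for s
    unfolding G_def by (rule suminf_pos[OF su]) (use u_pos that in auto)
  have "\<exists>s. 0 \<le> s \<and> s \<le> b \<and> G s - s = 0"
    by (rule IVT2'[OF _ _ \<open>0 \<le> b\<close> cont]) (use Gpos[of 0] \<open>G b \<le> b\<close> in auto)
  then obtain S where S: "0 \<le> S" "G S = S" by auto
  with Gpos[of S] have "0 < S" by simp
  show thesis
  proof (rule that[of S "\<lambda>n. u n S / w n"])
    show "0 < S" by fact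
    show "0 < u n S / w n" for n using u_pos[OF S(1)] w by simp
    have "(\<lambda>n. u n S) sums S" using summable_sums[OF su[OF S(1)]] S(2) by (simp add: G_def)
    then show "(\<lambda>n. w n * (u n S / w n)) sums S" using w by (simp add: less_imp_neq[symmetric])
    show "u n S / w n * (a n * w n * (u n S / w n) + \<kappa> * S) = 1" for n
      using u_eq[OF S(1), of n] w[of n] by (simp add: field_simps)
  qed
qed

section \<open>Chessboard labels\<close>

type_synonym label = "nat \<times> nat \<times> nat"

text \<open>The size is chosen so that \<open>2 / side n = (1 / 16) ^ (n + 2)\<close>, which is
  exactly the fourth power of half the weight of region \<open>n\<close>.\<close>

definition side :: "nat \<Rightarrow> nat" where
  "side n = 2 * 16 ^ (n + 2)"

text \<open>The share of the board attacked by a rook, its own cell included; row and column overlap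
  in that one cell.\<close>

definition rook_fraction :: "nat \<Rightarrow> real" where
  "rook_fraction n = (2 * real (side n) - 1) / (real (side n))\<^sup>2"

definition board :: "nat \<Rightarrow> (nat \<times> nat) set" where
  "board n = {..<side n} \<times> {..<side n}"

definition weight :: "nat pmf" where
  "weight = geometric_pmf (1 / 2)"

definition labels :: "label pmf" where
  "labels = bind_pmf weight (\<lambda>n. map_pmf (Pair n) (pmf_of_set (board n)))"

text \<open>The cost on labels. Natural values turn the Gibbs factor
  \<open>exp (- C / \<epsilon>)\<close> into a power of
  \<open>E = exp (- 1 / \<epsilon>)\<close>.\<close>

definition level :: "label \<Rightarrow> label \<Rightarrow> nat" where
  "level a b = (if fst a \<noteq> fst b then 4
     else if fst (snd a) = fst (snd b) \<or> snd (snd a) = snd (snd b) then 0 else 1)"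

definition valid :: "label \<Rightarrow> bool" where
  "valid a \<longleftrightarrow> snd a \<in> board (fst a)"

lemma level_commute: "level a b = level b a"
  by (auto simp: level_def)

lemma side_ge: "512 \<le> side n"
  by (simp add: side_def)

lemma board_finite [simp]: "finite (board n)" and board_nonempty [simp]: "board n \<noteq> {}"
  and card_board: "card (board n) = (side n)\<^sup>2"
  using side_ge[of n] by (auto simp: board_def card_cartesian_product power2_eq_square lessThan_empty_iff)

lemma pmf_weight: "pmf weight n = (1 / 2) ^ Suc n"
  by (simp add: weight_def)

lemma AE_valid: "AE a in labels. valid a"
  by (auto simp: AE_measure_pmf_iff labels_def valid_def)

lemma rook_fraction_pos: "0 < rook_fraction n"
  and rook_fraction_le: "rook_fraction n \<le> (1 / 16) ^ (n + 2)"
  and rook_fraction_half: "rook_fraction n \<le> 1 / 2"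
proof -
  have N: "512 \<le> real (side n)" using side_ge[of n] by linarith
  show "0 < rook_fraction n" using N by (simp add: rook_fraction_def)
  have "rook_fraction n \<le> (2 * real (side n)) / (real (side n))\<^sup>2"
    unfolding rook_fraction_def by (intro divide_right_mono) auto
  also have "\<dots> = 2 / real (side n)" using N by (simp add: power2_eq_square)
  finally have le: "rook_fraction n \<le> 2 / real (side n)" .
  also have "\<dots> = (1 / 16) ^ (n + 2)" by (simp add: side_def field_simps)
  finally show "rook_fraction n \<le> (1 / 16) ^ (n + 2)" .
  have "2 / real (side n) \<le> 1 / 2" using N by (simp add: field_simps)
  with le show "rook_fraction n \<le> 1 / 2" by linarith
qed

lemma measure_board_rook:
  assumes "(i, j) \<in> board n"
  shows "measure (pmf_of_set (board n)) {q. i = fst q \<or> j = snd q} = rook_fraction n"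
proof -
  let ?N = "side n"
  have ij: "i < ?N" "j < ?N" using assms by (auto simp: board_def)
  have "board n \<inter> {q. i = fst q \<or> j = snd q} = {i} \<times> {..<?N} \<union> {..<?N} \<times> {j}"
    using ij by (auto simp: board_def)
  moreover have "card ({i} \<times> {..<?N} \<union> {..<?N} \<times> {j}) + card (({i} \<times> {..<?N}) \<inter> ({..<?N} \<times> {j}))
      = card ({i} \<times> {..<?N}) + card ({..<?N} \<times> {j})"
    by (rule card_Un_Int[symmetric]) auto
  moreover have "({i} \<times> {..<?N}) \<inter> ({..<?N} \<times> {j}) = {(i, j)}" using ij by auto
  ultimately have "real (card (board n \<inter> {q. i = fst q \<or> j = snd q})) = 2 * real ?N - 1"
    by (simp add: card_cartesian_product)
  then show ?thesis
    by (simp add: measure_pmf_of_set rook_fraction_def card_board)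
qed

lemma nn_integral_weight: "(\<integral>\<^sup>+ n. f n \<partial>weight) = (\<Sum>n. ennreal (pmf weight n) * f n)"
  by (simp add: nn_integral_measure_pmf nn_integral_count_space_nat)

lemma nn_integral_labels_fst: "(\<integral>\<^sup>+ a. f (fst a) \<partial>labels) = (\<integral>\<^sup>+ n. f n \<partial>weight)"
  by (simp add: labels_def)

text \<open>A rook attacks equally many cells from every cell, so the joint law of region and cost
  of a random partner depends on \<open>a\<close> only through its region. This is why potentials
  that are constant on regions suffice.\<close>

lemma nn_integral_labels_level:
  fixes G :: "nat \<Rightarrow> nat \<Rightarrow> ennreal"
  assumes "valid a"
  shows "(\<integral>\<^sup>+ b. G (fst b) (level a b) \<partial>labels) =
    (\<integral>\<^sup>+ n. (if n = fst a then ennreal (rook_fraction n) * G n 0 + ennreal (1 - rook_fraction n) * G n 1 else G n 4) \<partial>weight)"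
proof -
  obtain n i j where a: "a = (n, i, j)" by (metis surj_pair)
  have ij: "(i, j) \<in> board n" using assms by (simp add: valid_def a)
  let ?A = "{q. i = fst q \<or> j = snd q}"
  let ?p = "measure_pmf (pmf_of_set (board n))"
  have A: "emeasure ?p ?A = rook_fraction n"
    by (simp add: measure_pmf.emeasure_eq_measure measure_board_rook[OF ij])
  have B: "emeasure ?p (- ?A) = 1 - rook_fraction n"
    using measure_pmf.prob_compl[of ?A "pmf_of_set (board n)"]
    by (simp add: measure_pmf.emeasure_eq_measure measure_board_rook[OF ij] Compl_eq_Diff_UNIV)
  have "(\<integral>\<^sup>+ q. G n (level (n, i, j) (n, q)) \<partial>?p)
      = (\<integral>\<^sup>+ q. G n 0 * indicator ?A q + G n 1 * indicator (- ?A) q \<partial>?p)"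
    by (rule nn_integral_cong) (auto simp: level_def indicator_def)
  also have "\<dots> = ennreal (rook_fraction n) * G n 0 + ennreal (1 - rook_fraction n) * G n 1"
    by (simp add: nn_integral_add nn_integral_cmult A B mult.commute)
  finally have *: "(\<integral>\<^sup>+ q. G n (level (n, i, j) (n, q)) \<partial>?p)
      = ennreal (rook_fraction n) * G n 0 + ennreal (1 - rook_fraction n) * G n 1" .
  have "(\<integral>\<^sup>+ q. G m (level a (m, q)) \<partial>measure_pmf (pmf_of_set (board m)))
      = (if m = n then ennreal (rook_fraction m) * G m 0 + ennreal (1 - rook_fraction m) * G m 1 else G m 4)" for m
    using * by (auto simp: level_def a)
  then show ?thesis by (simp add: labels_def a)
qed

section \<open>The space and the measure\<close>

definition encode_label :: "label \<Rightarrow> nat" where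
  "encode_label a = prod_encode (fst a, prod_encode (snd a))"

definition decode_label :: "nat \<Rightarrow> label" where
  "decode_label m = (fst (prod_decode m), prod_decode (snd (prod_decode m)))"

text \<open>The block of the label with code \<open>m\<close> is the interval from \<open>2 m\<close> to \<open>2 m + 1\<close>; also at its right
  endpoint \<open>x\<close> the floor of \<open>x / 2\<close> is \<open>m\<close>. Codes of labels outside the boards give blocks of
  measure zero.\<close>

definition points :: "real set" where
  "points = {x. 0 \<le> x \<and> x \<le> 2 * of_int \<lfloor>x / 2\<rfloor> + 1}"

definition label :: "real \<Rightarrow> label" where
  "label x = decode_label (nat \<lfloor>x / 2\<rfloor>)"

definition corner :: "label \<Rightarrow> real" where
  "corner a = 2 * real (encode_label a)"

text \<open>Blocks have length 1, so the constant value of the density on a block is the mass of the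
  block.\<close>

definition mu :: "real measure" where
  "mu = density (restrict_space lborel points) (\<lambda>x. ennreal (pmf labels (label x)))"

lemma decode_encode [simp]: "decode_label (encode_label a) = a"
  by (simp add: decode_label_def encode_label_def)

lemma encode_decode [simp]: "encode_label (decode_label m) = m"
  by (simp add: decode_label_def encode_label_def)

lemma floor_half: "x \<in> {2 * real m..2 * real m + 1} \<Longrightarrow> \<lfloor>x / 2\<rfloor> = int m"
  by (auto simp: floor_eq_iff)

definition block :: "label \<Rightarrow> real set" where
  "block a = {corner a..corner a + 1}"

lemma label_block: "x \<in> block a \<Longrightarrow> label x = a"
  and block_subset_points: "block a \<subseteq> points"
proof -
  have *: "label x = a \<and> x \<in> points" if "x \<in> block a" for x
  proof -
    have "\<lfloor>x / 2\<rfloor> = int (encode_label a)"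
      using that by (intro floor_half) (simp add: block_def corner_def)
    with that show ?thesis by (auto simp: points_def label_def corner_def block_def)
  qed
  then show "x \<in> block a \<Longrightarrow> label x = a" "block a \<subseteq> points" by blast+
qed

lemma in_block_label:
  assumes "x \<in> points"
  shows "x \<in> block (label x)"
proof -
  have x: "0 \<le> x" "x \<le> 2 * of_int \<lfloor>x / 2\<rfloor> + 1" using assms by (auto simp: points_def)
  have "corner (label x) = 2 * of_int \<lfloor>x / 2\<rfloor>" using x(1) by (simp add: corner_def label_def)
  moreover have "of_int \<lfloor>x / 2\<rfloor> \<le> x / 2" by (rule of_int_floor_le)
  ultimately show ?thesis unfolding block_def atLeastAtMost_iff using x(2) by linarith
qed

lemma points_label_eq: "{x \<in> points. label x = a} = block a"
  using label_block block_subset_points in_block_label by blast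

lemma corner_in_block: "corner a \<in> block a"
  by (simp add: block_def)

lemma corner_in_points [simp]: "corner a \<in> points" and label_corner [simp]: "label (corner a) = a"
  using corner_in_block[of a] block_subset_points label_block by blast+

text \<open>Corners are even integers and blocks have length 1, so distinct blocks are at distance
  at least 1. Hence functions of labels are locally constant on \<open>points\<close>, which is the
  source of all continuity and closedness below.\<close>

lemma label_eqI:
  assumes "x \<in> points" "y \<in> points" "\<bar>x - y\<bar> < 1"
  shows "label x = label y"
proof -
  have "\<bar>corner (label x) - corner (label y)\<bar> < 2"
    using in_block_label[OF assms(1)] in_block_label[OF assms(2)] assms(3)
    unfolding block_def atLeastAtMost_iff by linarith
  then have "encode_label (label x) = encode_label (label y)" unfolding corner_def by linarith
  then show ?thesis by (metis decode_encode)
qed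

section \<open>Topology of the union of blocks\<close>

lemma closed_points: "closed points"
proof -
  have "- points = {..<0} \<union> (\<Union>m::nat. {2 * real m + 1<..<2 * real m + 2})"
  proof (intro set_eqI iffI)
    fix x assume x: "x \<in> - points"
    show "x \<in> {..<0} \<union> (\<Union>m::nat. {2 * real m + 1<..<2 * real m + 2})"
    proof (cases "x < 0")
      case False
      define m where "m = nat \<lfloor>x / 2\<rfloor>"
      have m: "real m = of_int \<lfloor>x / 2\<rfloor>" using False by (simp add: m_def)
      have "x / 2 < of_int \<lfloor>x / 2\<rfloor> + 1" by linarith
      then have "x < 2 * real m + 2" using m by linarith
      moreover have "2 * real m + 1 < x"
        using x False unfolding m points_def by (simp add: not_le)
      ultimately show ?thesis by auto
    qed simp
  next
    fix x assume "x \<in> {..<0} \<union> (\<Union>m::nat. {2 * real m + 1<..<2 * real m + 2})"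
    then consider "x < 0" | m :: nat where "2 * real m + 1 < x" "x < 2 * real m + 2" by auto
    then show "x \<in> - points"
    proof cases
      case (2 m)
      then have "\<lfloor>x / 2\<rfloor> = int m" by (auto simp: floor_eq_iff)
      with 2 show ?thesis by (auto simp: points_def)
    qed (auto simp: points_def)
  qed
  moreover have "open ({..<0} \<union> (\<Union>m::nat. {2 * real m + 1<..<2 * real m + 2}))"
    by (intro open_Un open_UN ballI open_lessThan open_greaterThanLessThan)
  ultimately show ?thesis by (simp only: closed_def)
qed

lemma continuous_on_labels:
  fixes f :: "label \<Rightarrow> label \<Rightarrow> 'b::topological_space"
  shows "continuous_on (points \<times> points) (\<lambda>z. f (label (fst z)) (label (snd z)))"
proof -
  have "((\<lambda>z. f (label (fst z)) (label (snd z))) \<longlongrightarrow> f (label (fst w)) (label (snd w)))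
      (at w within points \<times> points)" if w: "w \<in> points \<times> points" for w
  proof (rule tendsto_eventually)
    show "\<forall>\<^sub>F z in at w within points \<times> points.
        f (label (fst z)) (label (snd z)) = f (label (fst w)) (label (snd w))"
      unfolding eventually_at
    proof (intro exI[of _ 1] conjI ballI impI)
      fix z assume z: "z \<in> points \<times> points" "z \<noteq> w \<and> dist z w < 1"
      have "dist (fst z) (fst w) < 1" "dist (snd z) (snd w) < 1"
        using z(2) dist_fst_le[of z w] dist_snd_le[of z w] by linarith+
      then show "f (label (fst z)) (label (snd z)) = f (label (fst w)) (label (snd w))"
        using z(1) w label_eqI[of "fst z" "fst w"] label_eqI[of "snd z" "snd w"]
        by (auto simp: dist_real_def)
    qed simp
  qed
  then show ?thesis by (simp add: continuous_on_def)
qed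

lemma closed_labels: "closed {z \<in> points \<times> points. Q (label (fst z)) (label (snd z))}"
proof -
  have "closed (points \<times> points \<inter> (\<lambda>z. if Q (label (fst z)) (label (snd z)) then 1 else 0 :: real) -` {1})"
    by (intro continuous_closed_preimage closed_Times closed_points closed_singleton
        continuous_on_labels[where f = "\<lambda>a b. if Q a b then 1 else 0"])
  also have "points \<times> points \<inter> (\<lambda>z. if Q (label (fst z)) (label (snd z)) then 1 else 0 :: real) -` {1}
      = {z \<in> points \<times> points. Q (label (fst z)) (label (snd z))}" by (auto split: if_splits)
  finally show ?thesis .
qed

section \<open>Borel structure of the space, and integrals of functions of labels\<close>

lemma points_borel [measurable]: "points \<in> sets borel"
  using closed_points by (rule borel_closed)

lemma measurable_label_borel [measurable]: "label \<in> borel \<rightarrow>\<^sub>M count_space UNIV"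
  unfolding label_def[abs_def] by measurable

lemma sets_mu: "sets mu = sets (restrict_space borel points)"
  unfolding mu_def by (simp add: sets_restrict_space_cong[OF sets_lborel])

lemma space_mu [simp]: "space mu = points"
  by (simp add: mu_def space_restrict_space)

lemma measurable_label [measurable]: "label \<in> mu \<rightarrow>\<^sub>M count_space UNIV"
  by (subst measurable_cong_sets[OF sets_mu refl]) (rule measurable_restrict_space1, measurable)

lemma emeasure_mu:
  assumes "A \<in> sets borel"
  shows "emeasure mu (A \<inter> points) = (\<integral>\<^sup>+ x. ennreal (pmf labels (label x)) * indicator (A \<inter> points) x \<partial>lborel)"
proof -
  have "A \<inter> points \<in> sets (restrict_space lborel points)"
    using assms by (auto simp: sets_restrict_space)
  then show ?thesis
    unfolding mu_def
    by (subst emeasure_density)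
      (auto simp: nn_integral_restrict_space measurable_restrict_space1 ac_simps
        intro!: nn_integral_cong split: split_indicator)
qed

lemma emeasure_mu_block:
  assumes "A \<in> sets borel" "A \<subseteq> block a"
  shows "emeasure mu A = ennreal (pmf labels a) * emeasure lborel A"
proof -
  have A: "A \<inter> points = A" using assms(2) block_subset_points by blast
  have "emeasure mu A = (\<integral>\<^sup>+ x. ennreal (pmf labels (label x)) * indicator A x \<partial>lborel)"
    using emeasure_mu[OF assms(1)] by (simp add: A)
  also have "\<dots> = (\<integral>\<^sup>+ x. ennreal (pmf labels a) * indicator A x \<partial>lborel)"
  proof (rule nn_integral_cong)
    fix x show "ennreal (pmf labels (label x)) * indicator A x = ennreal (pmf labels a) * indicator A x"
      using assms(2) label_block[of x a] by (cases "x \<in> A") auto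
  qed
  also have "\<dots> = ennreal (pmf labels a) * emeasure lborel A"
    using assms(1) by (simp add: nn_integral_cmult)
  finally show ?thesis .
qed

text \<open>Labels are countable, so singletons decide. Through this image measure, integrals of
  functions of labels become sums over regions and boards.\<close>

lemma distr_label: "distr mu (count_space UNIV) label = measure_pmf labels"
proof (rule measure_eqI_countable[of _ UNIV])
  fix a :: label
  have "label -` {a} \<inter> space mu = block a"
    using points_label_eq[of a] by auto
  then have "emeasure (distr mu (count_space UNIV) label) {a} = emeasure mu (block a)"
    by (subst emeasure_distr) auto
  also have "\<dots> = ennreal (pmf labels a) * emeasure lborel (block a)"
    by (rule emeasure_mu_block) (auto simp: block_def)
  also have "\<dots> = ennreal (pmf labels a)" by (simp add: block_def)
  finally show "emeasure (distr mu (count_space UNIV) label) {a} = emeasure (measure_pmf labels) {a}"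
    by (simp add: emeasure_pmf_single)
qed auto

lemma prob_space_mu: "prob_space mu"
  by (rule prob_space_distrD[of label _ "count_space UNIV"])
    (simp_all add: distr_label measure_pmf.prob_space_axioms)

interpretation mu: prob_space mu by (rule prob_space_mu)

lemma nn_integral_mu_label: "(\<integral>\<^sup>+ x. f (label x) \<partial>mu) = (\<integral>\<^sup>+ a. f a \<partial>labels)"
  by (subst distr_label[symmetric], subst nn_integral_distr) auto

lemma AE_mu_label: "(AE x in mu. Q (label x)) \<longleftrightarrow> (AE a in labels. Q a)"
  by (subst distr_label[symmetric], subst AE_distr_iff) auto

text \<open>Labels are countable, so the product of two discrete \<sigma>-algebras on them is again
  discrete and every function of a pair of labels is measurable.\<close>

lemma measurable_labels:
  fixes f :: "label \<Rightarrow> label \<Rightarrow> 'b"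
  assumes "\<And>a b. f a b \<in> space N"
  shows "(\<lambda>z. f (label (fst z)) (label (snd z))) \<in> mu \<Otimes>\<^sub>M mu \<rightarrow>\<^sub>M N"
proof -
  have "(\<lambda>z. (label (fst z), label (snd z))) \<in> mu \<Otimes>\<^sub>M mu \<rightarrow>\<^sub>M count_space UNIV \<Otimes>\<^sub>M count_space UNIV"
    by measurable
  then have "(\<lambda>z. (label (fst z), label (snd z))) \<in> mu \<Otimes>\<^sub>M mu \<rightarrow>\<^sub>M count_space (UNIV \<times> UNIV)"
    by (subst (asm) pair_measure_countable) auto
  from measurable_compose[OF this, of "case_prod f" N] assms show ?thesis by simp
qed

lemma nn_integral_labels:
  "(\<integral>\<^sup>+ z. f (label (fst z)) (label (snd z)) \<partial>(mu \<Otimes>\<^sub>M mu)) = (\<integral>\<^sup>+ a. \<integral>\<^sup>+ b. f a b \<partial>labels \<partial>labels)"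
proof -
  have "(\<integral>\<^sup>+ z. f (label (fst z)) (label (snd z)) \<partial>(mu \<Otimes>\<^sub>M mu))
      = (\<integral>\<^sup>+ x. \<integral>\<^sup>+ y. f (label x) (label y) \<partial>mu \<partial>mu)"
    by (subst mu.nn_integral_fst[symmetric], rule measurable_labels) simp_all
  also have "\<dots> = (\<integral>\<^sup>+ x. \<integral>\<^sup>+ b. f (label x) b \<partial>labels \<partial>mu)"
    by (simp add: nn_integral_mu_label)
  also have "\<dots> = (\<integral>\<^sup>+ a. \<integral>\<^sup>+ b. f a b \<partial>labels \<partial>labels)"
    by (rule nn_integral_mu_label)
  finally show ?thesis .
qed

lemma emeasure_mu_le: "A \<in> sets borel \<Longrightarrow> emeasure mu (A \<inter> points) \<le> emeasure lborel A"
  by (subst emeasure_mu, assumption, subst nn_integral_indicator[symmetric], simp, rule nn_integral_mono)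
    (auto simp: pmf_le_1 split: split_indicator)

text \<open>Probabilities of labels are at most 1, so \<open>mu\<close> is dominated by Lebesgue
  measure. Intervals of length half the mass of \<open>A\<close> cannot carry all of
  \<open>A\<close>, and one of the countably many that cover the line meets \<open>A\<close> in
  positive measure.\<close>

lemma nonatomic_mu: "nonatomic mu"
  unfolding nonatomic_def
proof (intro ballI impI)
  fix A assume A[measurable]: "A \<in> sets mu" and pos: "0 < emeasure mu A"
  define d where "d = measure mu A / 2"
  have d: "0 < d" "ennreal d < emeasure mu A"
    using pos by (auto simp: d_def mu.emeasure_eq_measure ennreal_less_iff)
  define I where "I k = points \<inter> {of_int k * d..(of_int k + 1) * d}" for k :: int
  have Im[measurable]: "I k \<in> sets mu" for k
    unfolding I_def sets_mu sets_restrict_space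
    by (rule imageI) (rule borel_closed[OF closed_atLeastAtMost])
  have I_le: "emeasure mu (I k) \<le> d" for k
  proof -
    have "emeasure mu ({of_int k * d..(of_int k + 1) * d} \<inter> points)
        \<le> emeasure lborel {of_int k * d..(of_int k + 1) * d}"
      by (rule emeasure_mu_le) (rule borel_closed[OF closed_atLeastAtMost])
    also have "\<dots> = ennreal ((of_int k + 1) * d - of_int k * d)"
      using d(1) by (intro emeasure_lborel_Icc mult_right_mono) auto
    also have "(of_int k + 1) * d - of_int k * d = d" by (simp add: distrib_right)
    finally show ?thesis unfolding I_def by (subst Int_commute)
  qed
  have cover: "A \<subseteq> (\<Union>k. A \<inter> I k)"
  proof
    fix x assume x: "x \<in> A"
    have "x \<in> points" using sets.sets_into_space[OF A] x by auto
    moreover have "of_int \<lfloor>x / d\<rfloor> \<le> x / d" "x / d \<le> of_int \<lfloor>x / d\<rfloor> + 1"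
      by (rule of_int_floor_le, rule real_of_int_floor_add_one_ge)
    then have "of_int \<lfloor>x / d\<rfloor> * d \<le> x" "x \<le> (of_int \<lfloor>x / d\<rfloor> + 1) * d"
      by (simp_all only: pos_le_divide_eq[OF d(1)] pos_divide_le_eq[OF d(1)])
    ultimately have "x \<in> I \<lfloor>x / d\<rfloor>" by (auto simp: I_def)
    with x show "x \<in> (\<Union>k. A \<inter> I k)" by blast
  qed
  have "\<exists>k. 0 < emeasure mu (A \<inter> I k)"
  proof (rule ccontr)
    assume "\<not> (\<exists>k. 0 < emeasure mu (A \<inter> I k))"
    then have "A \<inter> I k \<in> null_sets mu" for k
      using A Im by (intro null_setsI sets.Int) (simp_all add: zero_less_iff_neq_zero)
    then have "(\<Union>k. A \<inter> I k) \<in> null_sets mu" by (rule null_sets_UN)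
    from null_sets_subset[OF this A cover] pos show False by (simp add: null_setsD1)
  qed
  then obtain k where k: "0 < emeasure mu (A \<inter> I k)" by auto
  have "emeasure mu (A \<inter> I k) \<le> emeasure mu (I k)" by (rule emeasure_mono[OF Int_lower2 Im])
  also note I_le[of k]
  also note d(2)
  finally show "\<exists>B\<in>sets mu. B \<subseteq> A \<and> 0 < emeasure mu B \<and> emeasure mu B < emeasure mu A"
    using k A Im by (intro bexI[of _ "A \<inter> I k"] conjI Int_lower1 sets.Int)
qed

section \<open>Gibbs plans\<close>

abbreviation wt :: "nat \<Rightarrow> real" where
  "wt n \<equiv> pmf weight n"

text \<open>The average of \<open>E ^ level a b\<close> over the cells \<open>b\<close> of the board
  of \<open>a\<close>, when \<open>a\<close> is a valid label of region \<open>n\<close>.\<close>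

definition region_mean :: "real \<Rightarrow> nat \<Rightarrow> real" where
  "region_mean E n = rook_fraction n + (1 - rook_fraction n) * E"

text \<open>The system says that the Gibbs plan with potential \<open>v\<close> has the right marginals. The cost \<open>4\<close>
  between regions makes their interaction \<open>E ^ 4 * S \<le> E ^ 2\<close> negligible.\<close>

definition is_potential :: "real \<Rightarrow> (nat \<Rightarrow> real) \<Rightarrow> bool" where
  "is_potential E v \<longleftrightarrow> (\<forall>n. 0 < v n) \<and> (\<exists>B. \<forall>n. \<bar>ln (v n)\<bar> \<le> B) \<and>
     (\<exists>S>0. (\<lambda>n. wt n * v n) sums S \<and>
        (\<forall>n. v n * ((region_mean E n - E ^ 4) * wt n * v n + E ^ 4 * S) = 1))"

lemma wt_pos: "0 < wt n" and wt_le_1: "wt n \<le> 1"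
  by (simp add: pmf_weight, rule pmf_le_1)

lemma wt_sums: "wt sums 1"
  using power_half_series by (simp add: pmf_weight[abs_def])

lemma summable_sqrt_wt: "summable (\<lambda>n. sqrt (wt n))"
proof -
  have "summable (\<lambda>n. sqrt (1 / 2) * sqrt (1 / 2) ^ n)"
    by (intro summable_mult summable_geometric) (simp add: real_sqrt_divide)
  then show ?thesis
    by (simp only: pmf_weight power_Suc real_sqrt_mult real_sqrt_power)
qed

lemma region_mean_ge:
  assumes "0 < E" "E < 1"
  shows "E \<le> region_mean E n"
proof -
  have "region_mean E n - E = rook_fraction n * (1 - E)"
    by (simp add: region_mean_def algebra_simps)
  moreover have "0 \<le> rook_fraction n * (1 - E)" using rook_fraction_pos[of n] assms by simp
  ultimately show ?thesis by linarith
qed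

text \<open>The coefficients are at least \<open>E - E ^ 4\<close>, which is the uniform lower bound
  that the mean-field lemma requires. With \<open>h = E ^ 4 * S\<close>, the equation itself gives
  \<open>v n * h \<le> 1\<close> and then \<open>1 \<le> v n * (1 / h + h)\<close>. Thus
  \<open>ln (v n)\<close> is bounded, as the minimality criterion demands.\<close>

lemma potential_exists:
  assumes E: "0 < E" "E < 1"
  shows "\<exists>v. is_potential E v"
proof -
  have E4: "E ^ 4 < E ^ 1" by (rule power_strict_decreasing) (use E in auto)
  have d: "E - E ^ 4 \<le> region_mean E n - E ^ 4" for n
    using region_mean_ge[OF E, of n] by simp
  obtain v S where S: "0 < S" and v: "\<And>n. 0 < v n" and sums: "(\<lambda>n. wt n * v n) sums S"
    and eq: "\<And>n. v n * ((region_mean E n - E ^ 4) * wt n * v n + E ^ 4 * S) = 1"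
    by (rule quadratic_mean_field_solution[of wt "E - E ^ 4" "\<lambda>n. region_mean E n - E ^ 4" "E ^ 4"])
      (use E4 d E wt_pos summable_sqrt_wt in auto)
  define h where "h = E ^ 4 * S"
  have h: "0 < h" using S E by (simp add: h_def)
  have a0: "0 \<le> region_mean E n - E ^ 4" for n using d[of n] E4 by simp
  have a1: "region_mean E n - E ^ 4 \<le> 1" for n
  proof -
    have "region_mean E n \<le> rook_fraction n + (1 - rook_fraction n) * 1"
      unfolding region_mean_def using E rook_fraction_half[of n] by (intro add_left_mono mult_left_mono) auto
    then have "region_mean E n \<le> 1" by simp
    moreover have "0 < E ^ 4" using E by simp
    ultimately show ?thesis by linarith
  qed
  have up: "v n \<le> 1 / h" for n
  proof -
    have "0 \<le> v n * ((region_mean E n - E ^ 4) * wt n * v n)"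
      using v[of n] a0[of n] wt_pos[of n] by simp
    then have "v n * h \<le> 1" using eq[of n] by (simp add: h_def distrib_left)
    then show ?thesis using h by (simp add: field_simps)
  qed
  have low: "1 / (1 / h + h) \<le> v n" for n
  proof -
    have "(region_mean E n - E ^ 4) * wt n * v n \<le> 1 * 1 * (1 / h)"
      using a0[of n] a1[of n] wt_pos[of n] wt_le_1[of n] v[of n] up[of n]
      by (intro mult_mono) (auto intro: mult_nonneg_nonneg less_imp_le)
    then have "v n * ((region_mean E n - E ^ 4) * wt n * v n + h) \<le> v n * (1 / h + h)"
      using v[of n] by (intro mult_left_mono) auto
    then have "1 \<le> v n * (1 / h + h)" using eq[of n] by (simp add: h_def)
    moreover have "0 < 1 / h + h" using h by (simp add: add_pos_pos)
    ultimately show ?thesis by (simp add: pos_divide_le_eq)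
  qed
  have "\<bar>ln (v n)\<bar> \<le> \<bar>ln (1 / h)\<bar> + \<bar>ln (1 / (1 / h + h))\<bar>" for n
  proof -
    have "0 < 1 / (1 / h + h)" using h by (simp add: add_pos_pos)
    then have "ln (1 / (1 / h + h)) \<le> ln (v n)" using low[of n] v[of n] by (subst ln_le_cancel_iff) auto
    moreover have "ln (v n) \<le> ln (1 / h)" using up[of n] v[of n] h by (subst ln_le_cancel_iff) auto
    ultimately show ?thesis by linarith
  qed
  then have "\<exists>B. \<forall>n. \<bar>ln (v n)\<bar> \<le> B" by blast
  with S v sums eq show ?thesis unfolding is_potential_def by blast
qed

text \<open>With \<open>u = wt n * v n\<close> the equation is
  \<open>u\<^sup>2 * (region_mean E n - E ^ 4) + E ^ 4 * S * u = wt n\<close>. Everything rests on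
  bounding the interaction term \<open>E ^ 4 * S * u\<close> by \<open>E\<close>: it is at most
  \<open>E\<^sup>2 * u\<close>, and \<open>u * E \<le> 1\<close>. The lower bound matters in the
  region whose \<open>rook_fraction\<close> is comparable to \<open>E\<close>, the other two as
  \<open>E\<close> tends to 0 with \<open>n\<close> fixed.\<close>

lemma potential_estimates:
  assumes E: "0 < E" "E \<le> 1 / 2" and pot: "is_potential E v"
  shows potential_lower: "wt n - E \<le> (wt n * v n)\<^sup>2 * region_mean E n"
    and potential_upper: "(wt n * v n)\<^sup>2 * rook_fraction n \<le> wt n"
    and potential_rook: "wt n - (wt n * v n)\<^sup>2 * rook_fraction n \<le> E / rook_fraction n + E"
proof -
  obtain S where S: "0 < S" and v: "\<And>n. 0 < v n" and sums: "(\<lambda>n. wt n * v n) sums S"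
    and eq: "\<And>n. v n * ((region_mean E n - E ^ 4) * wt n * v n + E ^ 4 * S) = 1"
    using pot by (auto simp: is_potential_def)
  define r where "r = rook_fraction n"
  define u where "u = wt n * v n"
  have r: "0 < r" "r \<le> 1 / 2" unfolding r_def by (rule rook_fraction_pos, rule rook_fraction_half)
  have u: "0 < u" using v wt_pos by (simp add: u_def)
  have E3: "E ^ 3 \<le> (1 / 2) ^ 3" by (rule power_mono) (use E in auto)
  have E4: "E ^ 4 \<le> (1 / 2) * E"
    using mult_right_mono[OF E3, of E] E by (simp add: eval_nat_numeral)
  have rE: "region_mean E n = r + (1 - r) * E" by (simp add: region_mean_def r_def)
  have kE: "E / 2 \<le> region_mean E n - E ^ 4"
    using region_mean_ge[of E n] E E4 by simp
  have "(1 / 2) * E \<le> (1 - r) * E" using E r by (intro mult_right_mono) auto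
  \<comment> \<open>Because \<open>r \<le> 1 / 2\<close>, the cost-1 part \<open>(1 - r) * E\<close>
    of the mean absorbs the subtracted \<open>E ^ 4\<close>.\<close>
  then have kr: "r \<le> region_mean E n - E ^ 4" using E4 rE by linarith
  have main: "u\<^sup>2 * (region_mean E n - E ^ 4) + E ^ 4 * S * u = wt n"
  proof -
    have "wt n * (v n * ((region_mean E n - E ^ 4) * wt n * v n + E ^ 4 * S)) = wt n"
      by (simp add: eq)
    then show ?thesis by (simp add: u_def power2_eq_square algebra_simps)
  qed
  have "E ^ 4 * S * (wt m * v m) \<le> wt m" for m
  proof -
    have "E ^ 4 \<le> E" using E4 E by linarith
    then have "0 \<le> region_mean E m - E ^ 4" using region_mean_ge[of E m] E by simp
    then have "0 \<le> v m * ((region_mean E m - E ^ 4) * wt m * v m)"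
      using v[of m] wt_pos[of m] by simp
    then have "v m * (E ^ 4 * S) \<le> 1" using eq[of m] by (simp add: distrib_left)
    then have "wt m * (v m * (E ^ 4 * S)) \<le> wt m * 1" using wt_pos[of m] by (intro mult_left_mono) auto
    then show ?thesis by (simp add: ac_simps)
  qed
  \<comment> \<open>Each interaction term is at most the weight of its region. Summing over all
    regions replaces \<open>wt m * v m\<close> by \<open>S\<close> and the weights by 1.\<close>
  then have "E ^ 4 * S * S \<le> 1"
    using sums_le[OF _ sums_mult[OF sums, of "E ^ 4 * S"] wt_sums] by blast
  then have "(E\<^sup>2 * S)\<^sup>2 \<le> 1\<^sup>2" by (simp add: power_mult_distrib power2_eq_square eval_nat_numeral ac_simps)
  then have "E\<^sup>2 * S \<le> 1" by (rule power2_le_imp_le) simp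
  then have "E\<^sup>2 * (E\<^sup>2 * S) \<le> E\<^sup>2 * 1" by (intro mult_left_mono) auto
  then have c: "E ^ 4 * S \<le> E\<^sup>2" by (simp add: power2_eq_square eval_nat_numeral ac_simps)
  have cu0: "0 \<le> E ^ 4 * S * u" using E S u by simp
  have "u\<^sup>2 * E\<^sup>2 \<le> u\<^sup>2 * (region_mean E n - E ^ 4)"
  proof (rule mult_left_mono)
    have "E * E \<le> E * (1 / 2)" using E by (intro mult_left_mono) auto
    then show "E\<^sup>2 \<le> region_mean E n - E ^ 4" using kE by (simp add: power2_eq_square)
  qed simp
  then have "(u * E)\<^sup>2 \<le> 1\<^sup>2" using main cu0 wt_le_1[of n] by (simp add: power_mult_distrib)
  then have uE: "u * E \<le> 1" by (rule power2_le_imp_le) simp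
  have "E ^ 4 * S * u \<le> E\<^sup>2 * u" using c u by (intro mult_right_mono) auto
  also have "\<dots> = E * (u * E)" by (simp add: power2_eq_square)
  also have "\<dots> \<le> E * 1" using uE E by (intro mult_left_mono) auto
  finally have cu: "E ^ 4 * S * u \<le> E" by simp
  have "0 \<le> u\<^sup>2 * E ^ 4" using E by simp
  then show "wt n - E \<le> (wt n * v n)\<^sup>2 * region_mean E n"
    using main cu unfolding u_def[symmetric] right_diff_distrib by linarith
  have "u\<^sup>2 * r \<le> u\<^sup>2 * (region_mean E n - E ^ 4)" using kr by (intro mult_left_mono) auto
  then have ur: "u\<^sup>2 * r \<le> wt n" using main cu0 by linarith
  then show "(wt n * v n)\<^sup>2 * rook_fraction n \<le> wt n" by (simp add: u_def r_def)
  have "u\<^sup>2 \<le> 1 / r" using ur r wt_le_1[of n] by (simp add: pos_le_divide_eq)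
  then have "u\<^sup>2 * E \<le> 1 / r * E" using E by (intro mult_right_mono) auto
  moreover have "u\<^sup>2 * (region_mean E n - E ^ 4) \<le> u\<^sup>2 * (r + E)"
  proof (rule mult_left_mono)
    have "0 \<le> r * E" "0 \<le> E ^ 4" using r E by simp_all
    then show "region_mean E n - E ^ 4 \<le> r + E" by (simp add: rE algebra_simps)
  qed simp
  ultimately have "wt n - u\<^sup>2 * r \<le> E / r + E" using main cu by (simp add: algebra_simps)
  then show "wt n - (wt n * v n)\<^sup>2 * rook_fraction n \<le> E / rook_fraction n + E"
    by (simp add: u_def r_def)
qed

lemma nn_integral_weight_single:
  "(\<integral>\<^sup>+ m. (if m = n then c else 0) \<partial>weight) = ennreal (wt n) * c"
proof -
  have "(\<integral>\<^sup>+ m. (if m = n then c else 0) \<partial>weight) = (\<integral>\<^sup>+ m. c * indicator {n} m \<partial>weight)"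
    by (rule nn_integral_cong) (auto simp: indicator_def)
  then show ?thesis by (simp add: nn_integral_cmult emeasure_pmf_single mult.commute)
qed

section \<open>Gibbs plans and the limit plan as couplings\<close>

definition gibbs_density :: "real \<Rightarrow> (nat \<Rightarrow> real) \<Rightarrow> label \<Rightarrow> label \<Rightarrow> ennreal" where
  "gibbs_density E v a b = ennreal (v (fst a) * v (fst b) * E ^ level a b)"

text \<open>The constant is the reciprocal of the \<open>mu\<close>-mass of the zero-cost partners
  of a point with valid label in the region: given the first coordinate, the plan draws a partner
  from \<open>mu\<close> conditioned on zero cost.\<close>

definition limit_density :: "label \<Rightarrow> label \<Rightarrow> ennreal" where
  "limit_density a b =
     (if level a b = 0 then ennreal (1 / (wt (fst a) * rook_fraction (fst a))) else 0)"

definition label_plan :: "(label \<Rightarrow> label \<Rightarrow> ennreal) \<Rightarrow> (real \<times> real) measure" where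
  "label_plan f = density (mu \<Otimes>\<^sub>M mu) (\<lambda>z. f (label (fst z)) (label (snd z)))"

lemma sets_label_plan [simp, measurable_cong]: "sets (label_plan f) = sets (mu \<Otimes>\<^sub>M mu)"
  by (simp add: label_plan_def)

lemma space_label_plan [simp]: "space (label_plan f) = points \<times> points"
  by (simp add: label_plan_def space_pair_measure)

lemma label_set_measurable [measurable]:
  "{z \<in> points \<times> points. Q (label (fst z)) (label (snd z))} \<in> sets (mu \<Otimes>\<^sub>M mu)"
proof -
  have "{z \<in> space (mu \<Otimes>\<^sub>M mu). Q (label (fst z)) (label (snd z))} \<in> sets (mu \<Otimes>\<^sub>M mu)"
    using measurable_labels[of Q "count_space UNIV"] by (simp add: pred_def)
  then show ?thesis by (simp add: space_pair_measure)
qed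

lemma emeasure_label_plan:
  "emeasure (label_plan f) {z \<in> points \<times> points. Q (label (fst z)) (label (snd z))}
    = (\<integral>\<^sup>+ a. \<integral>\<^sup>+ b. (if Q a b then f a b else 0) \<partial>labels \<partial>labels)"
proof -
  let ?A = "{z \<in> points \<times> points. Q (label (fst z)) (label (snd z))}"
  have "emeasure (label_plan f) ?A
      = (\<integral>\<^sup>+ z. f (label (fst z)) (label (snd z)) * indicator ?A z \<partial>(mu \<Otimes>\<^sub>M mu))"
    unfolding label_plan_def
    by (rule emeasure_density) (auto intro: measurable_labels label_set_measurable)
  also have "\<dots> = (\<integral>\<^sup>+ z. (\<lambda>a b. if Q a b then f a b else 0) (label (fst z)) (label (snd z)) \<partial>(mu \<Otimes>\<^sub>M mu))"
    by (rule nn_integral_cong) (auto simp: space_pair_measure split: split_indicator)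
  also have "\<dots> = (\<integral>\<^sup>+ a. \<integral>\<^sup>+ b. (if Q a b then f a b else 0) \<partial>labels \<partial>labels)"
    by (rule nn_integral_labels)
  finally show ?thesis .
qed

text \<open>Invalid labels have probability zero, so rows of valid labels suffice, and symmetry
  turns the row condition into the column condition.\<close>

lemma label_plan_coupling:
  assumes row: "\<And>a. valid a \<Longrightarrow> (\<integral>\<^sup>+ b. f a b \<partial>labels) = 1" and sym: "\<And>a b. f a b = f b a"
  shows "label_plan f \<in> couplings mu mu"
proof -
  have row': "AE x in mu. (\<integral>\<^sup>+ y. f (label x) (label y) \<partial>mu) = 1"
  proof -
    have "AE a in labels. (\<integral>\<^sup>+ b. f a b \<partial>labels) = 1" using AE_valid row by auto
    then have "AE x in mu. (\<integral>\<^sup>+ b. f (label x) b \<partial>labels) = 1"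
      using AE_mu_label[of "\<lambda>a. (\<integral>\<^sup>+ b. f a b \<partial>labels) = 1"] by simp
    then show ?thesis by (simp add: nn_integral_mu_label)
  qed
  moreover from row' have "AE y in mu. (\<integral>\<^sup>+ x. f (label x) (label y) \<partial>mu) = 1"
    by (simp add: sym[of "label _" "label y" for y])
  ultimately show ?thesis
    unfolding label_plan_def
    by (intro density_in_couplings prob_space_mu measurable_labels) simp_all
qed

lemma ennreal_convex_combination:
  assumes "0 \<le> r" "r \<le> 1" "0 \<le> x" "0 \<le> y"
  shows "ennreal r * ennreal x + ennreal (1 - r) * ennreal y = ennreal (r * x + (1 - r) * y)"
  using assms by (simp add: ennreal_mult)

lemma gibbs_row:
  assumes E: "0 < E" "E < 1" and pot: "is_potential E v" and a: "valid a"
  shows "(\<integral>\<^sup>+ b. gibbs_density E v a b \<partial>labels) = 1"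
proof -
  obtain S where S: "0 < S" and v: "\<And>n. 0 < v n" and sums: "(\<lambda>n. wt n * v n) sums S"
    and eq: "\<And>n. v n * ((region_mean E n - E ^ 4) * wt n * v n + E ^ 4 * S) = 1"
    using pot by (auto simp: is_potential_def)
  define n where "n = fst a"
  define r where "r = rook_fraction n"
  have r: "0 \<le> r" "r \<le> 1"
    using rook_fraction_pos[of n] rook_fraction_half[of n] by (auto simp: r_def)
  define k where "k m = (if m = n then region_mean E n else E ^ 4)" for m
  have k0: "0 \<le> k m" for m using E region_mean_ge[OF E, of n] by (simp add: k_def)
  have "(\<integral>\<^sup>+ b. gibbs_density E v a b \<partial>labels)
      = (\<integral>\<^sup>+ m. ennreal (v n * v m * k m) \<partial>weight)"
    unfolding gibbs_density_def n_def[symmetric]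
  proof (subst nn_integral_labels_level[OF a, of "\<lambda>m l. ennreal (v n * v m * E ^ l)"],
      rule nn_integral_cong, unfold n_def[symmetric])
    fix m
    have "ennreal r * ennreal (v n * v n * E ^ 0) + ennreal (1 - r) * ennreal (v n * v n * E ^ 1)
        = ennreal (r * (v n * v n * E ^ 0) + (1 - r) * (v n * v n * E ^ 1))"
      using r v[of n] E by (intro ennreal_convex_combination) auto
    also have "r * (v n * v n * E ^ 0) + (1 - r) * (v n * v n * E ^ 1) = v n * v n * region_mean E n"
      by (simp add: region_mean_def r_def algebra_simps)
    finally show "(if m = n then ennreal (rook_fraction m) * ennreal (v n * v m * E ^ 0)
          + ennreal (1 - rook_fraction m) * ennreal (v n * v m * E ^ 1)
        else ennreal (v n * v m * E ^ 4)) = ennreal (v n * v m * k m)"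
      by (simp add: k_def r_def)
  qed
  also have "\<dots> = (\<Sum>m. ennreal (wt m * (v n * v m * k m)))"
    unfolding nn_integral_weight using wt_pos by (simp add: ennreal_mult'' ennreal_mult' less_imp_le)
  also have "\<dots> = 1"
  proof -
    \<comment> \<open>The factor \<open>E ^ 4\<close> is charged to all regions, including region
      \<open>n\<close> itself; the single extra term corrects this to
      \<open>region_mean E n\<close>. Hence the coefficient \<open>region_mean E n - E ^ 4\<close>
      in \<open>is_potential\<close>.\<close>
    have "(\<lambda>m. v n * E ^ 4 * (wt m * v m) + (if m = n then v n * (wt n * v n * (region_mean E n - E ^ 4)) else 0))
       sums (v n * E ^ 4 * S + v n * (wt n * v n * (region_mean E n - E ^ 4)))"
      by (intro sums_add sums_mult sums sums_single)
    also have "(\<lambda>m. v n * E ^ 4 * (wt m * v m) + (if m = n then v n * (wt n * v n * (region_mean E n - E ^ 4)) else 0))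
       = (\<lambda>m. wt m * (v n * v m * k m))"
      by (auto simp: k_def algebra_simps)
    also have "v n * E ^ 4 * S + v n * (wt n * v n * (region_mean E n - E ^ 4)) = 1"
      using eq[of n] by (simp add: algebra_simps)
    finally have "(\<lambda>m. wt m * (v n * v m * k m)) sums 1" .
    moreover have "0 \<le> wt m * (v n * v m * k m)" for m
      using wt_pos[of m] v[of n] v[of m] k0[of m] by (simp add: less_imp_le)
    ultimately have "(\<Sum>m. ennreal (wt m * (v n * v m * k m))) = ennreal 1"
      by (intro suminf_ennreal_eq) auto
    then show ?thesis by simp
  qed
  finally show ?thesis .
qed

lemma gibbs_commute: "gibbs_density E v a b = gibbs_density E v b a"
  by (simp add: gibbs_density_def level_commute[of a b] mult.commute)

lemma gibbs_coupling:
  "0 < E \<Longrightarrow> E < 1 \<Longrightarrow> is_potential E v \<Longrightarrow> label_plan (gibbs_density E v) \<in> couplings mu mu"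
  by (rule label_plan_coupling[OF gibbs_row gibbs_commute])

lemma limit_coupling: "label_plan limit_density \<in> couplings mu mu"
proof (rule label_plan_coupling)
  fix a b
  show "limit_density a b = limit_density b a"
    by (auto simp: limit_density_def level_commute[of a b]) (auto simp: level_def split: if_splits)
next
  fix a assume a: "valid a"
  define n where "n = fst a"
  define c where "c = 1 / (wt n * rook_fraction n)"
  have c: "0 \<le> c" "wt n * (rook_fraction n * c) = 1"
    using wt_pos[of n] rook_fraction_pos[of n] by (simp_all add: c_def)
  have "(\<integral>\<^sup>+ b. limit_density a b \<partial>labels)
      = (\<integral>\<^sup>+ b. (if level a b = 0 then ennreal c else 0) \<partial>labels)"
    unfolding limit_density_def c_def n_def ..
  also have "\<dots> = (\<integral>\<^sup>+ m. (if m = n then ennreal (rook_fraction n * c) else 0) \<partial>weight)"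
    by (subst nn_integral_labels_level[OF a, of "\<lambda>m l. if l = 0 then ennreal c else 0"],
        rule nn_integral_cong)
      (use rook_fraction_pos[of n] c in \<open>auto simp: n_def ennreal_mult\<close>)
  also have "\<dots> = 1"
    unfolding nn_integral_weight_single using c wt_pos[of n] by (simp flip: ennreal_mult')
  finally show "(\<integral>\<^sup>+ b. limit_density a b \<partial>labels) = 1" .
qed

text \<open>On \<open>G\<close> the first measure is below the second, so on any set its excess is
  at most its mass outside \<open>G\<close>. Passing to complements bounds the difference of
  opposite sign.\<close>

lemma tv_dist_density_le:
  assumes fm: "f \<in> borel_measurable R" and gm: "g \<in> borel_measurable R"
    and Pf: "prob_space (density R f)" and Pg: "prob_space (density R g)" and G: "G \<in> sets R"
    and le: "\<And>x. x \<in> G \<Longrightarrow> f x \<le> g x" and zero: "\<And>x. x \<in> space R - G \<Longrightarrow> g x = 0"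
  shows "tv_dist (density R f) (density R g) \<le> 1 - measure (density R f) G"
    and "0 \<le> tv_dist (density R f) (density R g)"
proof -
  define P where "P = density R f"
  define Q where "Q = density R g"
  interpret P: prob_space P using Pf by (simp add: P_def)
  interpret Q: prob_space Q using Pg by (simp add: Q_def)
  have sP: "sets P = sets R" "sets Q = sets R" by (simp_all add: P_def Q_def)
  have one: "measure P A - measure Q A \<le> 1 - measure P G" if A: "A \<in> sets R" for A
  proof -
    have "emeasure P (A \<inter> G) \<le> emeasure Q A"
      unfolding P_def Q_def using A G fm gm
      by (simp add: emeasure_density, intro nn_integral_mono) (auto simp: le split: split_indicator)
    then have "measure P (A \<inter> G) \<le> measure Q A"
      by (simp add: P.emeasure_eq_measure Q.emeasure_eq_measure)
    moreover have "measure P A = measure P (A \<inter> G) + measure P (A - G)"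
      using A G sP by (subst P.finite_measure_Union[symmetric]) (auto intro!: arg_cong[where f = "measure P"])
    moreover have "measure P (A - G) \<le> measure P (space P - G)"
      using A G sP sets.sets_into_space[of A P] by (intro P.finite_measure_mono) auto
    moreover have "measure P (space P - G) = 1 - measure P G" using G sP by (intro P.prob_compl) simp
    ultimately show ?thesis by linarith
  qed
  have both: "\<bar>measure P A - measure Q A\<bar> \<le> 1 - measure P G" if A: "A \<in> sets R" for A
  proof -
    have sp: "space P = space R" "space Q = space R" by (simp_all add: P_def Q_def)
    have "measure P (space R - A) = 1 - measure P A" "measure Q (space R - A) = 1 - measure Q A"
      using P.prob_compl[of A] Q.prob_compl[of A] A sP by (simp_all add: sp)
    moreover have "measure P (space R - A) - measure Q (space R - A) \<le> 1 - measure P G"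
      by (rule one) (use A in auto)
    ultimately show ?thesis using one[OF A] by linarith
  qed
  have "tv_dist P Q \<le> 1 - measure P G"
    unfolding tv_dist_def by (rule cSUP_least) (use both sP in auto)
  moreover have "0 \<le> tv_dist P Q"
    unfolding tv_dist_def
    by (rule cSUP_upper2[of _ _ "{}"]) (use both sP in \<open>auto intro!: bdd_aboveI2[of _ _ "1 - measure P G"]\<close>)
  ultimately show "tv_dist (density R f) (density R g) \<le> 1 - measure (density R f) G"
    "0 \<le> tv_dist (density R f) (density R g)"
    by (simp_all add: P_def Q_def)
qed

section \<open>Minimality of the Gibbs plans and optimality of the limit plan\<close>

definition label_cost :: "real \<times> real \<Rightarrow> real" where
  "label_cost z = real (level (label (fst z)) (label (snd z)))"

lemma level_le: "level a b \<le> 4"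
  by (simp add: level_def)

lemma label_cost_measurable [measurable]: "label_cost \<in> borel_measurable (mu \<Otimes>\<^sub>M mu)"
  unfolding label_cost_def[abs_def] by (rule measurable_labels) simp

lemma gibbs_minimiser:
  assumes \<epsilon>: "0 < \<epsilon>" and pot: "is_potential (exp (- 1 / \<epsilon>)) v"
  shows "entropic_minimiser mu mu label_cost \<epsilon> (label_plan (gibbs_density (exp (- 1 / \<epsilon>)) v))"
    and "finiteness_assumption mu mu label_cost"
proof -
  let ?E = "exp (- 1 / \<epsilon>)"
  \<comment> \<open>\<open>v\<close> is the exponential of the potential, and the same potential
    serves both marginals.\<close>
  define \<phi> where "\<phi> x = ln (v (fst (label x)))" for x
  obtain B where B: "\<And>n. \<bar>ln (v n)\<bar> \<le> B" and v: "\<And>n. 0 < v n"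
    using pot by (auto simp: is_potential_def)
  have E: "0 < ?E" "?E < 1" using \<epsilon> by auto
  have \<phi>m: "\<phi> \<in> borel_measurable mu"
    unfolding \<phi>_def by (rule measurable_compose[OF measurable_label]) simp
  have dens: "gibbs_density ?E v (label (fst z)) (label (snd z))
      = ennreal (exp (\<phi> (fst z) + \<phi> (snd z) - label_cost z / \<epsilon>))" for z
  proof -
    define l where "l = level (label (fst z)) (label (snd z))"
    have "?E ^ l = exp (- (real l / \<epsilon>))" by (simp flip: exp_of_nat_mult)
    then show ?thesis
      using v by (simp add: gibbs_density_def label_cost_def \<phi>_def l_def exp_add exp_diff exp_minus divide_inverse)
  qed
  have "label_plan (gibbs_density ?E v)
      = density (mu \<Otimes>\<^sub>M mu) (\<lambda>(x, y). ennreal (exp (\<phi> x + \<phi> y - label_cost (x, y) / \<epsilon>)))"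
    unfolding label_plan_def dens by (simp add: case_prod_beta')
  note * = prob_space_mu prob_space_mu \<epsilon> label_cost_measurable \<phi>m \<phi>m _ _ _ _ this gibbs_coupling[OF E pot]
  have c: "0 \<le> label_cost z" "label_cost z \<le> 4" for z
    using level_le by (auto simp: label_cost_def)
  have b: "\<bar>\<phi> x\<bar> \<le> B" for x using B by (simp add: \<phi>_def)
  show "entropic_minimiser mu mu label_cost \<epsilon> (label_plan (gibbs_density ?E v))"
    by (rule entropic_minimiser_density[OF *]) (rule c b)+
  show "finiteness_assumption mu mu label_cost"
    by (rule finiteness_assumption_density[OF *]) (rule c b)+
qed

lemma limit_optimal: "optimal_plan mu mu label_cost (label_plan limit_density)"
proof -
  have "transport_cost label_cost (label_plan limit_density)
      = (\<integral>\<^sup>+ z. limit_density (label (fst z)) (label (snd z)) * ennreal (label_cost z) \<partial>(mu \<Otimes>\<^sub>M mu))"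
    unfolding transport_cost_def label_plan_def
    by (rule nn_integral_density) (auto intro: measurable_labels)
  also have "\<dots> = (\<integral>\<^sup>+ z. 0 \<partial>(mu \<Otimes>\<^sub>M mu))"
    by (rule nn_integral_cong) (simp add: limit_density_def label_cost_def)
  finally have "transport_cost label_cost (label_plan limit_density) = 0" by simp
  then show ?thesis using limit_coupling by (simp add: optimal_plan_def is_arg_min_def)
qed

section \<open>Masses of zero-cost and cost-1 pairs, and convergence in total variation\<close>

definition rook_set :: "(real \<times> real) set" where
  "rook_set = {z \<in> points \<times> points. level (label (fst z)) (label (snd z)) = 0}"

lemma summable_rook_mass:
  assumes "0 < E" "E \<le> 1 / 2" "is_potential E v"
  shows "summable (\<lambda>n. (wt n * v n)\<^sup>2 * rook_fraction n)"
proof (rule summable_comparison_test'[OF sums_summable[OF wt_sums], of 0])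
  fix n
  show "norm ((wt n * v n)\<^sup>2 * rook_fraction n) \<le> wt n"
    using potential_upper[OF assms, of n] rook_fraction_pos[of n] by (simp add: abs_of_pos)
qed

lemma gibbs_mass_rook:
  assumes E: "0 < E" "E \<le> 1 / 2" and pot: "is_potential E v"
  shows "measure (label_plan (gibbs_density E v)) rook_set = (\<Sum>n. (wt n * v n)\<^sup>2 * rook_fraction n)"
proof -
  have v: "0 < v n" for n using pot by (auto simp: is_potential_def)
  have "emeasure (label_plan (gibbs_density E v)) rook_set
      = (\<integral>\<^sup>+ a. \<integral>\<^sup>+ b. (if level a b = 0 then gibbs_density E v a b else 0) \<partial>labels \<partial>labels)"
    unfolding rook_set_def by (rule emeasure_label_plan)
  also have "\<dots> = (\<integral>\<^sup>+ a. ennreal (wt (fst a) * (rook_fraction (fst a) * (v (fst a))\<^sup>2)) \<partial>labels)"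
  proof (rule nn_integral_cong_AE, use AE_valid in eventually_elim)
    fix a assume a: "valid a"
    define n where "n = fst a"
    have r: "0 \<le> rook_fraction n" using rook_fraction_pos[of n] by simp
    have "(\<integral>\<^sup>+ b. (if level a b = 0 then gibbs_density E v a b else 0) \<partial>labels)
        = (\<integral>\<^sup>+ b. (if level a b = 0 then ennreal (v n * v (fst b)) else 0) \<partial>labels)"
      by (rule nn_integral_cong) (simp add: gibbs_density_def n_def)
    also have "\<dots> = (\<integral>\<^sup>+ m. (if m = n then ennreal (rook_fraction n * (v n)\<^sup>2) else 0) \<partial>weight)"
      by (subst nn_integral_labels_level[OF a, of "\<lambda>m l. if l = 0 then ennreal (v n * v m) else 0"],
          rule nn_integral_cong)
        (use v[of n] r in \<open>auto simp: n_def[symmetric] ennreal_mult power2_eq_square\<close>)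
    also have "\<dots> = ennreal (wt n * (rook_fraction n * (v n)\<^sup>2))"
      unfolding nn_integral_weight_single using r by (simp add: ennreal_mult')
    finally show "(\<integral>\<^sup>+ b. (if level a b = 0 then gibbs_density E v a b else 0) \<partial>labels)
        = ennreal (wt (fst a) * (rook_fraction (fst a) * (v (fst a))\<^sup>2))" by (simp add: n_def)
  qed
  also have "\<dots> = (\<integral>\<^sup>+ n. ennreal (wt n * (rook_fraction n * (v n)\<^sup>2)) \<partial>weight)"
    by (rule nn_integral_labels_fst)
  also have "\<dots> = (\<Sum>n. ennreal ((wt n * v n)\<^sup>2 * rook_fraction n))"
    unfolding nn_integral_weight
  proof (rule arg_cong[where f = suminf], rule ext)
    fix n
    show "ennreal (wt n) * ennreal (wt n * (rook_fraction n * (v n)\<^sup>2)) = ennreal ((wt n * v n)\<^sup>2 * rook_fraction n)"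
      by (subst ennreal_mult'[symmetric]) (simp_all add: power2_eq_square algebra_simps)
  qed
  also have "\<dots> = ennreal (\<Sum>n. (wt n * v n)\<^sup>2 * rook_fraction n)"
    using rook_fraction_pos by (intro suminf_ennreal2 summable_rook_mass[OF E pot]) (simp add: less_imp_le)
  finally show ?thesis
    using rook_fraction_pos summable_rook_mass[OF E pot]
    by (simp add: measure_def suminf_nonneg less_imp_le)
qed

lemma gibbs_mass_off_rook:
  assumes E: "0 < E" and pot: "is_potential E v"
  shows "emeasure (label_plan (gibbs_density E v))
      {z \<in> points \<times> points. fst (label (fst z)) = n \<and> level (label (fst z)) (label (snd z)) = 1}
    = ennreal ((wt n * v n)\<^sup>2 * ((1 - rook_fraction n) * E))"
proof -
  have v: "0 < v n" for n using pot by (auto simp: is_potential_def)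
  have r: "0 \<le> 1 - rook_fraction n" using rook_fraction_half[of n] by simp
  define c where "c = (1 - rook_fraction n) * ((v n)\<^sup>2 * E)"
  have c: "0 \<le> c" using r E by (simp add: c_def)
  have "emeasure (label_plan (gibbs_density E v))
      {z \<in> points \<times> points. fst (label (fst z)) = n \<and> level (label (fst z)) (label (snd z)) = 1}
      = (\<integral>\<^sup>+ a. \<integral>\<^sup>+ b. (if fst a = n \<and> level a b = 1 then gibbs_density E v a b else 0) \<partial>labels \<partial>labels)"
    by (rule emeasure_label_plan)
  also have "\<dots> = (\<integral>\<^sup>+ a. (if fst a = n then ennreal (wt n) * ennreal c else 0) \<partial>labels)"
  proof (rule nn_integral_cong_AE, use AE_valid in eventually_elim)
    fix a assume a: "valid a"
    show "(\<integral>\<^sup>+ b. (if fst a = n \<and> level a b = 1 then gibbs_density E v a b else 0) \<partial>labels)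
        = (if fst a = n then ennreal (wt n) * ennreal c else 0)"
    proof (cases "fst a = n")
      case True
      have "(\<integral>\<^sup>+ b. (if fst a = n \<and> level a b = 1 then gibbs_density E v a b else 0) \<partial>labels)
          = (\<integral>\<^sup>+ b. (if level a b = 1 then ennreal (v n * v (fst b) * E) else 0) \<partial>labels)"
        by (rule nn_integral_cong) (simp add: gibbs_density_def True)
      also have "\<dots> = (\<integral>\<^sup>+ m. (if m = n then ennreal c else 0) \<partial>weight)"
        by (subst nn_integral_labels_level[OF a, of "\<lambda>m l. if l = 1 then ennreal (v n * v m * E) else 0"],
            rule nn_integral_cong)
          (use v[of n] r E in \<open>auto simp: True c_def ennreal_mult power2_eq_square\<close>)
      finally show ?thesis using True by (simp add: nn_integral_weight_single)
    qed simp
  qed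
  also have "\<dots> = ennreal (wt n) * (ennreal (wt n) * ennreal c)"
    by (subst nn_integral_labels_fst[of "\<lambda>m. if m = n then ennreal (wt n) * ennreal c else 0"])
      (rule nn_integral_weight_single)
  also have "\<dots> = ennreal (wt n * (wt n * c))"
    using c by (simp add: ennreal_mult')
  also have "wt n * (wt n * c) = (wt n * v n)\<^sup>2 * ((1 - rook_fraction n) * E)"
    by (simp add: c_def power2_eq_square algebra_simps)
  finally show ?thesis .
qed

text \<open>By \<open>potential_upper\<close>, the Gibbs density does not exceed the limit density
  on zero-cost pairs, and the limit density vanishes elsewhere. So the distance is at most the Gibbs
  mass off \<open>rook_set\<close>.\<close>

lemma gibbs_tv_bound:
  assumes E: "0 < E" "E \<le> 1 / 2" and pot: "is_potential E v"
  shows "tv_dist (label_plan (gibbs_density E v)) (label_plan limit_density)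
      \<le> (\<Sum>n. wt n - (wt n * v n)\<^sup>2 * rook_fraction n)"
    and "0 \<le> tv_dist (label_plan (gibbs_density E v)) (label_plan limit_density)"
proof -
  have E1: "E < 1" using E by simp
  have v: "0 < v n" for n using pot by (auto simp: is_potential_def)
  have le: "gibbs_density E v a b \<le> limit_density a b" if "level a b = 0" for a b
  proof -
    have ab: "fst a = fst b" using that by (auto simp: level_def split: if_splits)
    define n where "n = fst a"
    have "wt n * ((v n)\<^sup>2 * (wt n * rook_fraction n)) \<le> wt n * 1"
      using potential_upper[OF E pot, of n] by (simp add: power2_eq_square ac_simps)
    then have "(v n)\<^sup>2 * (wt n * rook_fraction n) \<le> 1" using wt_pos[of n] by (simp add: mult_le_cancel_left)
    then have "(v n)\<^sup>2 \<le> 1 / (wt n * rook_fraction n)"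
      using wt_pos[of n] rook_fraction_pos[of n] by (simp add: pos_le_divide_eq)
    then show ?thesis
      using that ab by (auto simp: gibbs_density_def limit_density_def n_def power2_eq_square intro!: ennreal_leI)
  qed
  have P: "prob_space (label_plan (gibbs_density E v))" "prob_space (label_plan limit_density)"
    using gibbs_coupling[OF E(1) E1 pot] limit_coupling by (auto simp: couplings_def)
  have m: "(\<lambda>z. gibbs_density E v (label (fst z)) (label (snd z))) \<in> borel_measurable (mu \<Otimes>\<^sub>M mu)"
      "(\<lambda>z. limit_density (label (fst z)) (label (snd z))) \<in> borel_measurable (mu \<Otimes>\<^sub>M mu)"
    by (rule measurable_labels, simp)+
  have G: "rook_set \<in> sets (mu \<Otimes>\<^sub>M mu)" unfolding rook_set_def by (rule label_set_measurable)
  have z1: "gibbs_density E v (label (fst z)) (label (snd z)) \<le> limit_density (label (fst z)) (label (snd z))"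
    if "z \<in> rook_set" for z using that by (intro le) (simp add: rook_set_def)
  have z2: "limit_density (label (fst z)) (label (snd z)) = 0"
    if "z \<in> space (mu \<Otimes>\<^sub>M mu) - rook_set" for z
    using that by (auto simp: rook_set_def limit_density_def space_pair_measure)
  note tv = tv_dist_density_le[OF m P[unfolded label_plan_def] G z1 z2, folded label_plan_def]
  show "0 \<le> tv_dist (label_plan (gibbs_density E v)) (label_plan limit_density)" by (rule tv)
  have "(\<Sum>n. wt n - (wt n * v n)\<^sup>2 * rook_fraction n)
      = 1 - measure (label_plan (gibbs_density E v)) rook_set"
    unfolding gibbs_mass_rook[OF E pot] sums_unique[OF wt_sums]
    by (rule suminf_diff[symmetric, OF sums_summable[OF wt_sums] summable_rook_mass[OF E pot]])
  with tv(1) show "tv_dist (label_plan (gibbs_density E v)) (label_plan limit_density)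
      \<le> (\<Sum>n. wt n - (wt n * v n)\<^sup>2 * rook_fraction n)" by simp
qed

lemma exp_minus_inverse_tendsto: "((\<lambda>\<epsilon>::real. exp (- 1 / \<epsilon>)) \<longlongrightarrow> 0) (at_right 0)"
proof -
  have "filterlim (\<lambda>\<epsilon>::real. - inverse \<epsilon>) at_bot (at_right 0)"
    using filterlim_inverse_at_top_right by (simp add: filterlim_uminus_at_top)
  from filterlim_compose[OF exp_at_bot this] show ?thesis by (simp add: divide_inverse)
qed

text \<open>For fixed \<open>n\<close> the estimate \<open>potential_rook\<close> tends to 0 with
  \<epsilon>, but not uniformly in \<open>n\<close>. The weights are a summable majorant, so
  dominated convergence for series (Tannery) applies.\<close>

lemma gibbs_tv_tendsto:
  assumes pot: "\<And>\<epsilon>. 0 < \<epsilon> \<Longrightarrow> is_potential (exp (- 1 / \<epsilon>)) (v \<epsilon>)"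
  shows "((\<lambda>\<epsilon>. tv_dist (label_plan (gibbs_density (exp (- 1 / \<epsilon>)) (v \<epsilon>))) (label_plan limit_density))
    \<longlongrightarrow> 0) (at_right 0)"
proof -
  \<comment> \<open>The mass of region \<open>n\<close> that the Gibbs plan does not put on
    zero-cost pairs.\<close>
  define a where "a n \<epsilon> = wt n - (wt n * v \<epsilon> n)\<^sup>2 * rook_fraction n" for n \<epsilon>
  have "\<forall>\<^sub>F \<epsilon> in at_right (0::real). exp (- 1 / \<epsilon>) < 1 / 2"
    using exp_minus_inverse_tendsto by (rule order_tendstoD) simp
  then have small: "\<forall>\<^sub>F \<epsilon> in at_right (0::real). 0 < \<epsilon> \<and> exp (- 1 / \<epsilon>) \<le> 1 / 2"
    using eventually_at_right_less[of "0::real"] by eventually_elim simp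
  have a0: "0 \<le> a n \<epsilon>" and a1: "a n \<epsilon> \<le> wt n"
    and a2: "a n \<epsilon> \<le> exp (- 1 / \<epsilon>) / rook_fraction n + exp (- 1 / \<epsilon>)"
    if "0 < \<epsilon> \<and> exp (- 1 / \<epsilon>) \<le> 1 / 2" for n \<epsilon>
    using potential_upper[OF _ _ pot, of \<epsilon> n] potential_rook[OF _ _ pot, of \<epsilon> n] that
      rook_fraction_pos[of n] by (auto simp: a_def)
  have lim: "((\<lambda>\<epsilon>. a n \<epsilon>) \<longlongrightarrow> 0) (at_right 0)" for n
  proof (rule tendsto_sandwich)
    show "\<forall>\<^sub>F \<epsilon> in at_right 0. 0 \<le> a n \<epsilon>" using small by eventually_elim (rule a0)
    show "\<forall>\<^sub>F \<epsilon> in at_right 0. a n \<epsilon> \<le> exp (- 1 / \<epsilon>) / rook_fraction n + exp (- 1 / \<epsilon>)"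
      using small by eventually_elim (rule a2)
    show "((\<lambda>\<epsilon>::real. exp (- 1 / \<epsilon>) / rook_fraction n + exp (- 1 / \<epsilon>)) \<longlongrightarrow> 0) (at_right 0)"
      using tendsto_add[OF tendsto_divide[OF exp_minus_inverse_tendsto tendsto_const[of "rook_fraction n"]]
          exp_minus_inverse_tendsto] rook_fraction_pos[of n] by simp
  qed simp
  have "((\<lambda>\<epsilon>. \<Sum>n. a n \<epsilon>) \<longlongrightarrow> (\<Sum>n. 0)) (at_right 0)"
  proof (rule tannerys_theorem[OF lim _ sums_summable[OF wt_sums], THEN conjunct2, THEN conjunct2])
    have "\<forall>\<^sub>F \<epsilon> in at_right 0. \<forall>n. norm (a n \<epsilon>) \<le> wt n"
      using small by eventually_elim (use a0 a1 in simp)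
    then have "\<forall>\<^sub>F (n, \<epsilon>) in at_top \<times>\<^sub>F at_right 0. (\<forall>n. norm (a n \<epsilon>) \<le> wt n)"
      unfolding case_prod_beta by (rule eventually_compose_filterlim[OF _ filterlim_snd])
    then show "\<forall>\<^sub>F (n, \<epsilon>) in at_top \<times>\<^sub>F at_right 0. norm (a n \<epsilon>) \<le> wt n"
      by eventually_elim auto
  qed simp
  then have *: "((\<lambda>\<epsilon>. \<Sum>n. a n \<epsilon>) \<longlongrightarrow> 0) (at_right 0)" by simp
  show ?thesis
  proof (rule tendsto_sandwich[OF _ _ tendsto_const *])
    show "\<forall>\<^sub>F \<epsilon> in at_right 0. 0 \<le> tv_dist (label_plan (gibbs_density (exp (- 1 / \<epsilon>)) (v \<epsilon>))) (label_plan limit_density)"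
      using small by eventually_elim (rule gibbs_tv_bound[OF _ _ pot], auto)
    show "\<forall>\<^sub>F \<epsilon> in at_right 0. tv_dist (label_plan (gibbs_density (exp (- 1 / \<epsilon>)) (v \<epsilon>))) (label_plan limit_density)
        \<le> (\<Sum>n. a n \<epsilon>)"
      unfolding a_def using small by eventually_elim (rule gibbs_tv_bound[OF _ _ pot], auto)
  qed
qed

section \<open>Support, rate and large deviations\<close>

lemma pmf_labels_pos: "valid a \<Longrightarrow> 0 < pmf labels a"
  by (intro pmf_positive) (cases a, auto simp: labels_def valid_def weight_def set_pmf_geometric)

lemma mu_open_block_pos:
  assumes "open A" "x \<in> A" "x \<in> points" "valid (label x)"
  shows "0 < emeasure mu (A \<inter> block (label x))"
proof -
  define c where "c = corner (label x)"
  obtain e where e: "0 < e" "ball x e \<subseteq> A" using assms(1,2) by (auto simp: open_contains_ball)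
  have x: "c \<le> x" "x \<le> c + 1" using in_block_label[OF assms(3)] by (auto simp: block_def c_def)
  \<comment> \<open>The point \<open>x\<close> may be an endpoint of its block, so the interval
    around it is clipped to the block; it stays nondegenerate because the block has length
    1.\<close>
  define l where "l = max c (x - e / 2)"
  define u where "u = min (c + 1) (x + e / 2)"
  have lu: "l < u" using x e(1) by (auto simp: l_def u_def)
  have sub: "{l..u} \<subseteq> A \<inter> block (label x)"
  proof -
    have "{l..u} \<subseteq> ball x e" using e(1) by (auto simp: l_def u_def dist_real_def)
    moreover have "{l..u} \<subseteq> block (label x)" by (auto simp: l_def u_def block_def c_def)
    ultimately show ?thesis using e(2) by blast
  qed
  have "0 < ennreal (pmf labels (label x)) * emeasure lborel {l..u}"
    using pmf_labels_pos[OF assms(4)] lu by (simp add: ennreal_zero_less_mult_iff)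
  also have "\<dots> = emeasure mu {l..u}"
    using sub by (intro emeasure_mu_block[symmetric]) auto
  also have "\<dots> \<le> emeasure mu (A \<inter> block (label x))"
  proof (rule emeasure_mono[OF sub])
    have "A \<inter> block (label x) \<in> sets borel" using assms(1) by (auto simp: block_def)
    moreover have "A \<inter> block (label x) = points \<inter> (A \<inter> block (label x))"
      using block_subset_points by blast
    ultimately show "A \<inter> block (label x) \<in> sets mu"
      unfolding sets_mu sets_restrict_space by blast
  qed
  finally show ?thesis .
qed

text \<open>The plane is second countable, so its Borel sets are those of the product
  \<sigma>-algebra, and the identity is measurable from \<open>mu \<Otimes>\<^sub>M mu\<close> to
  \<open>borel\<close>.\<close>

lemma open_Int_points_measurable:
  assumes "open (U :: (real \<times> real) set)"
  shows "U \<inter> points \<times> points \<in> sets (mu \<Otimes>\<^sub>M mu)"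
proof -
  have [measurable]: "(\<lambda>x. x) \<in> mu \<rightarrow>\<^sub>M borel"
    by (subst measurable_cong_sets[OF sets_mu refl]) (rule measurable_restrict_space1, simp)
  have "(\<lambda>z. (fst z, snd z)) \<in> mu \<Otimes>\<^sub>M mu \<rightarrow>\<^sub>M borel \<Otimes>\<^sub>M borel"
    by (intro measurable_Pair measurable_compose[OF measurable_fst, of "\<lambda>x. x"]
        measurable_compose[OF measurable_snd, of "\<lambda>x. x"]) measurable
  then have "(\<lambda>z. z) \<in> mu \<Otimes>\<^sub>M mu \<rightarrow>\<^sub>M (borel :: (real \<times> real) measure)"
    by (simp add: borel_prod)
  from measurable_sets[OF this, of U] assms show ?thesis
    by (simp add: space_pair_measure)
qed

text \<open>The limit density is a positive constant on the product of two blocks joined by a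
  zero-cost pair, and \<open>mu\<close> charges every relatively open piece of a valid
  block.\<close>

lemma rook_in_support:
  assumes z: "z \<in> rook_set" "valid (label (fst z))" "valid (label (snd z))"
  shows "z \<in> measure_support (label_plan limit_density)"
  unfolding measure_support_def
proof (intro CollectI conjI allI impI)
  show "z \<in> space (label_plan limit_density)" using z(1) by (simp add: rook_set_def)
  fix U :: "(real \<times> real) set" assume U: "open U" "z \<in> U"
  obtain x y where xy: "z = (x, y)" by (cases z)
  have p: "x \<in> points" "y \<in> points" and lev: "level (label x) (label y) = 0"
    using z(1) by (auto simp: rook_set_def xy)
  obtain A B where AB: "open A" "open B" "z \<in> A \<times> B" "A \<times> B \<subseteq> U"
    using U by (rule open_prod_elim)
  then have "x \<in> A" "y \<in> B" by (simp_all add: xy)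
  define A' where "A' = A \<inter> block (label x)"
  define B' where "B' = B \<inter> block (label y)"
  have pos: "0 < emeasure mu A'" "0 < emeasure mu B'"
    unfolding A'_def B'_def using z(2,3)
    by (simp_all add: mu_open_block_pos AB p xy \<open>x \<in> A\<close> \<open>y \<in> B\<close>)
  \<comment> \<open>\<open>emeasure\<close> is 0 on nonmeasurable sets, so positivity already yields
    measurability.\<close>
  have s: "A' \<in> sets mu" "B' \<in> sets mu"
    using pos emeasure_notin_sets[of A' mu] emeasure_notin_sets[of B' mu]
    by (cases "A' \<in> sets mu"; cases "B' \<in> sets mu"; simp)+
  define c where "c = limit_density (label x) (label y)"
  have c: "0 < c"
    using wt_pos[of "fst (label x)"] rook_fraction_pos[of "fst (label x)"] lev
    by (simp add: c_def limit_density_def)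
  have lab: "label a = label x" if "a \<in> A'" for a using that label_block by (auto simp: A'_def)
  have lab': "label b = label y" if "b \<in> B'" for b using that label_block by (auto simp: B'_def)
  have "0 < c * (emeasure mu A' * emeasure mu B')"
    using c pos by (simp add: ennreal_zero_less_mult_iff)
  also have "\<dots> = (\<integral>\<^sup>+ w. c * indicator (A' \<times> B') w \<partial>(mu \<Otimes>\<^sub>M mu))"
    using s by (simp add: nn_integral_cmult mu.emeasure_pair_measure_Times)
  also have "\<dots> = (\<integral>\<^sup>+ w. limit_density (label (fst w)) (label (snd w)) * indicator (A' \<times> B') w \<partial>(mu \<Otimes>\<^sub>M mu))"
    by (rule nn_integral_cong) (auto simp: c_def lab lab' split: split_indicator)
  also have "\<dots> = emeasure (label_plan limit_density) (A' \<times> B')"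
    unfolding label_plan_def using s by (subst emeasure_density) (auto intro: measurable_labels)
  also have "\<dots> \<le> emeasure (label_plan limit_density) (U \<inter> points \<times> points)"
  proof (rule emeasure_mono)
    show "A' \<times> B' \<subseteq> U \<inter> points \<times> points"
      using AB(4) block_subset_points unfolding A'_def B'_def by blast
  qed (simp add: open_Int_points_measurable[OF U(1)])
  finally show "0 < emeasure (label_plan limit_density) (U \<inter> space (label_plan limit_density))"
    by simp
qed

text \<open>The code of a label is at least its region number, so the corners
  \<open>corner (n, q)\<close> are unbounded.\<close>

lemma not_compact_corners:
  fixes y :: "nat \<Rightarrow> 'a::real_normed_vector"
  assumes "\<And>n. (corner (n, q), y n) \<in> S"
  shows "\<not> compact S"
proof
  assume "compact S"
  then obtain B where B: "\<And>z. z \<in> S \<Longrightarrow> norm z \<le> B" by (meson bounded_iff compact_imp_bounded)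
  obtain n :: nat where n: "B < real n" using reals_Archimedean2 by blast
  have "n \<le> encode_label (n, q)" by (simp add: encode_label_def le_prod_encode_1)
  then have "real n \<le> norm (corner (n, q))" by (simp add: corner_def)
  also have "\<dots> \<le> norm (corner (n, q), y n)" by (rule norm_fst_le)
  also have "\<dots> \<le> B" using assms by (rule B)
  finally show False using n by simp
qed

text \<open>Validity places the auxiliary point of the rate estimate in a block that
  \<open>mu\<close> charges, so the rate is at least 1 at every point of the set and not just almost
  everywhere. It costs no mass.\<close>

definition off_rook_set :: "(real \<times> real) set" where
  "off_rook_set = {z \<in> points \<times> points. level (label (fst z)) (label (snd z)) = 1 \<and>
     valid (label (fst z)) \<and> valid (label (snd z))}"

text \<open>If \<open>x\<close> and \<open>y\<close> share neither row nor column, let \<open>p\<close> be in the row of \<open>x\<close> and the column of \<open>y\<close>: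
  swapping partners between \<open>(x, y)\<close> and \<open>(p, p)\<close> makes the cost zero.\<close>

lemma rate_off_rook:
  assumes "z \<in> off_rook_set"
  shows "1 \<le> rate label_cost (measure_support (label_plan limit_density)) z"
proof -
  obtain n i j k l where a: "label (fst z) = (n, i, j)" and b: "label (snd z) = (n, k, l)"
    and v: "i < side n" "j < side n" "k < side n" "l < side n" and ne: "i \<noteq> k" "j \<noteq> l"
    using assms
    by (cases "label (fst z)"; cases "label (snd z)")
      (auto simp: off_rook_set_def level_def valid_def board_def split: if_splits)
  define p where "p = corner (n, i, l)"
  define w where "w m = (if m = 1 then z else (p, p))" for m :: nat
  have lp: "label p = (n, i, l)" by (simp add: p_def)
  have "(p, p) \<in> measure_support (label_plan limit_density)"
    by (rule rook_in_support) (use v in \<open>auto simp: rook_set_def level_def valid_def board_def p_def\<close>)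
  moreover have "Transposition.transpose 1 2 permutes {1..2::nat}" by (rule permutes_swap_id) auto
  ultimately have "ereal ((\<Sum>m=1..2. label_cost (w m)) - (\<Sum>m=1..2. label_cost (fst (w m), snd (w (Transposition.transpose 1 2 m)))))
      \<le> rate label_cost (measure_support (label_plan limit_density)) z"
    unfolding rate_def by (intro SUP_upper2[of "(2, w, Transposition.transpose 1 2)"]) (auto simp: w_def)
  moreover have "(\<Sum>m=1..2. label_cost (w m)) = 1"
    using ne by (simp add: numeral_2_eq_2 w_def label_cost_def a b lp level_def)
  moreover have "(\<Sum>m=1..2. label_cost (fst (w m), snd (w (Transposition.transpose 1 2 m)))) = 0"
    by (simp add: numeral_2_eq_2 w_def label_cost_def a b lp level_def)
  ultimately show ?thesis by (simp add: one_ereal_def)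
qed

text \<open>At this \<open>E\<close> the fraction \<open>r\<close> of region \<open>n\<close> is at
  most \<open>E\<close>, hence \<open>region_mean E n \<le> 2 * E\<close>. Then
  \<open>potential_lower\<close> forces \<open>(wt n * v n)\<^sup>2 * E \<ge> wt n / 4\<close>, and
  the factor \<open>1 - r \<ge> 1 / 2\<close> leaves \<open>wt n / 8\<close>.\<close>

lemma gibbs_off_rook_ge:
  assumes E: "E = (1 / 16) ^ (n + 2)" and pot: "is_potential E v"
  shows "(1 / 2) ^ (n + 4) \<le> measure (label_plan (gibbs_density E v)) off_rook_set"
proof -
  have E0: "0 < E" by (simp add: E)
  have "E \<le> (1 / 2) ^ (n + 2)" unfolding E by (rule power_mono) auto
  then have Ew: "E \<le> wt n / 2" by (simp add: pmf_weight)
  with wt_le_1[of n] have E2: "E \<le> 1 / 2" by simp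
  have E1: "E < 1" using E2 by simp
  interpret P: prob_space "label_plan (gibbs_density E v)"
    using gibbs_coupling[OF E0 E1 pot] by (simp add: couplings_def)
  define r where "r = rook_fraction n"
  define q where "q = (wt n * v n)\<^sup>2 * E"
  have r: "0 < r" "r \<le> 1 / 2" "r \<le> E"
    unfolding r_def E by (rule rook_fraction_pos, rule rook_fraction_half, rule rook_fraction_le)
  have "r + (1 - r) * E \<le> E + 1 * E" using r E0 by (intro add_mono mult_right_mono) auto
  then have "(wt n * v n)\<^sup>2 * region_mean E n \<le> (wt n * v n)\<^sup>2 * (2 * E)"
    by (intro mult_left_mono) (auto simp: region_mean_def r_def)
  with potential_lower[OF E0 E2 pot, of n] have "wt n - E \<le> 2 * q" by (simp add: q_def)
  with Ew have q: "wt n / 4 \<le> q" by simp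
  have "q * (1 / 2) \<le> q * (1 - r)" using r E0 by (intro mult_left_mono) (auto simp: q_def)
  moreover have "(1 / 2) ^ (n + 4) = wt n / 8" by (simp add: pmf_weight power_add power_divide)
  ultimately have "(1 / 2) ^ (n + 4) \<le> q * (1 - r)" using q by linarith
  then have "ennreal ((1 / 2) ^ (n + 4)) \<le> ennreal ((wt n * v n)\<^sup>2 * ((1 - rook_fraction n) * E))"
    by (intro ennreal_leI) (simp add: q_def r_def ac_simps)
  also have "\<dots> = emeasure (label_plan (gibbs_density E v))
      {z \<in> points \<times> points. fst (label (fst z)) = n \<and> level (label (fst z)) (label (snd z)) = 1}"
    by (rule gibbs_mass_off_rook[OF E0 pot, symmetric])
  also have "\<dots> \<le> emeasure (label_plan (gibbs_density E v)) off_rook_set"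
  proof -
    have "(\<integral>\<^sup>+ b. (if fst a = n \<and> level a b = 1 then gibbs_density E v a b else 0) \<partial>labels)
        \<le> (\<integral>\<^sup>+ b. (if level a b = 1 \<and> valid a \<and> valid b then gibbs_density E v a b else 0) \<partial>labels)"
      if "valid a" for a
      by (rule nn_integral_mono_AE, use AE_valid in eventually_elim) (use that in auto)
    then show ?thesis
      unfolding off_rook_set_def emeasure_label_plan
        emeasure_label_plan[of _ "\<lambda>a b. level a b = 1 \<and> valid a \<and> valid b"]
        emeasure_label_plan[of _ "\<lambda>a b. fst a = n \<and> level a b = 1"]
      by (intro nn_integral_mono_AE, use AE_valid in eventually_elim)
  qed
  finally show ?thesis by (simp add: P.emeasure_eq_measure)
qed

text \<open>Along \<open>\<epsilon> = 1 / ((n + 2) * ln 16)\<close> the factor \<open>exp (- 1 / \<epsilon>)\<close> is \<open>2 / side n\<close>, which matches the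
  fraction of zero-cost pairs in region \<open>n\<close>.\<close>

lemma Limsup_gibbs:
  assumes pot: "\<And>\<epsilon>. 0 < \<epsilon> \<Longrightarrow> is_potential (exp (- 1 / \<epsilon>)) (v \<epsilon>)"
  shows "ereal (- 1 / 2) \<le> Limsup (at_right 0)
    (\<lambda>\<epsilon>. ereal \<epsilon> * elog (measure (label_plan (gibbs_density (exp (- 1 / \<epsilon>)) (v \<epsilon>))) off_rook_set))"
    (is "_ \<le> Limsup _ ?f")
proof (rule ccontr)
  assume "\<not> ereal (- 1 / 2) \<le> Limsup (at_right 0) ?f"
  then have ev: "\<forall>\<^sub>F \<epsilon> in at_right 0. ?f \<epsilon> < ereal (- 1 / 2)"
    by (intro Limsup_lessD) simp
  define e where "e n = inverse (real (Suc (Suc n))) / ln 16" for n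
  have e0: "0 < e n" for n by (simp add: e_def)
  have "e \<longlonglongrightarrow> 0 / ln 16"
    unfolding e_def[abs_def]
    by (intro tendsto_divide LIMSEQ_Suc[OF LIMSEQ_inverse_real_of_nat] tendsto_const) simp
  then have "filterlim e (at_right 0) sequentially"
    using e0 by (intro tendsto_imp_filterlim_at_right) simp_all
  from eventually_compose_filterlim[OF ev this]
  obtain n where n: "?f (e n) < ereal (- 1 / 2)"
    by (auto simp: eventually_sequentially)
  have ln16: "ln 16 = 4 * ln (2::real)"
    using ln_realpow[of 2 4] by simp
  have "- 1 / e n = - (real (n + 2) * ln 16)" by (simp add: e_def field_simps)
  moreover have "exp (real (n + 2) * ln 16) = 16 ^ (n + 2)"
    by (simp only: exp_of_nat_mult) simp
  ultimately have En: "exp (- 1 / e n) = (1 / 16) ^ (n + 2)"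
    by (simp only: exp_minus power_one_over inverse_eq_divide)
  define m where "m = measure (label_plan (gibbs_density (exp (- 1 / e n)) (v (e n)))) off_rook_set"
  have m: "(1 / 2) ^ (n + 4) \<le> m"
    unfolding m_def by (rule gibbs_off_rook_ge[OF En pot[OF e0]])
  have m0: "0 < m" by (rule less_le_trans[OF _ m]) simp
  have "ln ((1 / 2) ^ (n + 4)) \<le> ln m" using m m0 by (subst ln_le_cancel_iff) auto
  then have "- (real (n + 4) * ln 2) \<le> ln m" by (simp add: ln_realpow ln_div)
  then have "e n * (- (real (n + 4) * ln 2)) \<le> e n * ln m" using e0[of n] by (intro mult_left_mono) auto
  moreover have "e n * (real (n + 4) * ln 2) = real (n + 4) / (4 * real (n + 2))"
  proof -
    have "inverse N / (4 * L) * (K * L) = K / (4 * N)" if "0 < L" for N L K :: real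
      using that by (simp add: inverse_eq_divide)
    moreover have "Suc (Suc n) = n + 2" by simp
    ultimately show ?thesis unfolding e_def ln16 by (simp only: ln_gt_zero one_less_numeral_iff semiring_norm)
  qed
  \<comment> \<open>The quotient decreases to 1/4 and equals 1/2 at \<open>n = 0\<close>. The
    uniform bound 1/2 holds along the whole sequence and is already below the rate 1.\<close>
  moreover have "real (n + 4) / (4 * real (n + 2)) \<le> 1 / 2" by (simp add: field_simps)
  ultimately have "- 1 / 2 \<le> e n * ln m" by linarith
  moreover have "?f (e n) = ereal (e n * ln m)"
    unfolding m_def[symmetric] using m0 by (simp add: elog_def)
  ultimately show False using n by simp
qed

theorem theorem1p1:
  shows "\<exists>(X::real set) (\<mu>::real measure) (C::real \<times> real \<Rightarrow> real).
    closed X \<and> borel_prob_on X \<mu> \<and> nonatomic \<mu> \<and>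
    continuous_on (X \<times> X) C \<and> (\<forall>z\<in>X \<times> X. 0 \<le> C z) \<and>
    finiteness_assumption \<mu> \<mu> C \<and>
    (\<exists>P::real \<Rightarrow> (real \<times> real) measure.
       (\<forall>\<epsilon>>0. entropic_minimiser \<mu> \<mu> C \<epsilon> (P \<epsilon>)) \<and>
       (\<exists>Pstar. optimal_plan \<mu> \<mu> C Pstar \<and>
          ((\<lambda>\<epsilon>. tv_dist (P \<epsilon>) Pstar) \<longlongrightarrow> 0) (at_right 0) \<and>
          \<not> compact (measure_support Pstar) \<and>
          (\<exists>F. F \<subseteq> X \<times> X \<and> closed F \<and> \<not> compact F \<and>
             0 < (INF z\<in>F. rate C (measure_support Pstar) z) \<and>
             - (INF z\<in>F. rate C (measure_support Pstar) z)
               < Limsup (at_right 0) (\<lambda>\<epsilon>. ereal \<epsilon> * elog (measure (P \<epsilon>) F)))))"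
proof -
  have "\<exists>v. is_potential (exp (- 1 / \<epsilon>)) v" if "0 < \<epsilon>" for \<epsilon> :: real
    using that by (intro potential_exists) auto
  then obtain v where pot: "\<And>\<epsilon>. 0 < \<epsilon> \<Longrightarrow> is_potential (exp (- 1 / \<epsilon>)) (v \<epsilon>)" by metis
  let ?I = "INF z\<in>off_rook_set. rate label_cost (measure_support (label_plan limit_density)) z"
  have I: "1 \<le> ?I" by (rule INF_greatest) (rule rate_off_rook)
  have side: "1 < side n" "0 < side n" for n using side_ge[of n] by auto
  have nc1: "\<not> compact (measure_support (label_plan limit_density))"
    \<comment> \<open>The diagonal points over the cells \<open>(0, 0)\<close> are zero-cost pairs
      in every region.\<close>
    by (rule not_compact_corners[of "(0, 0)" "\<lambda>n. corner (n, 0, 0)"], rule rook_in_support)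
      (use side in \<open>auto simp: rook_set_def level_def valid_def board_def\<close>)
  have nc2: "\<not> compact off_rook_set"
    \<comment> \<open>The cells \<open>(0, 0)\<close> and \<open>(1, 1)\<close> share neither row
      nor column.\<close>
    by (rule not_compact_corners[of "(0, 0)" "\<lambda>n. corner (n, 1, 1)"])
      (use side in \<open>auto simp: off_rook_set_def level_def valid_def board_def\<close>)
  have "0 < ?I" by (rule less_le_trans[OF _ I]) simp
  have "- ?I \<le> - 1" using I by (simp add: ereal_uminus_le_reorder)
  also have "- 1 < ereal (- 1 / 2)" by (simp add: one_ereal_def)
  also note Limsup_gibbs[OF pot]
  finally have lim: "- ?I < Limsup (at_right 0)
    (\<lambda>\<epsilon>. ereal \<epsilon> * elog (measure (label_plan (gibbs_density (exp (- 1 / \<epsilon>)) (v \<epsilon>))) off_rook_set))" .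
  show ?thesis
  proof (intro exI[of _ points] exI[of _ mu] exI[of _ label_cost] conjI
      exI[of _ "\<lambda>\<epsilon>. label_plan (gibbs_density (exp (- 1 / \<epsilon>)) (v \<epsilon>))"]
      exI[of _ "label_plan limit_density"] exI[of _ off_rook_set] allI impI)
    show "borel_prob_on points mu" by (simp add: borel_prob_on_def prob_space_mu sets_mu)
    show "continuous_on (points \<times> points) label_cost"
      unfolding label_cost_def[abs_def] by (rule continuous_on_labels)
    show "\<forall>z\<in>points \<times> points. 0 \<le> label_cost z" by (simp add: label_cost_def)
    \<comment> \<open>The assumption does not involve \<epsilon>, so the Gibbs plan at
      \<open>\<epsilon> = 1\<close> witnesses it.\<close>
    show "finiteness_assumption mu mu label_cost" by (rule gibbs_minimiser(2)[OF zero_less_one pot]) simp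
    show "off_rook_set \<subseteq> points \<times> points" by (auto simp: off_rook_set_def)
    show "closed off_rook_set" unfolding off_rook_set_def by (rule closed_labels)
    show "closed points" "nonatomic mu" by (rule closed_points, rule nonatomic_mu)
    show "entropic_minimiser mu mu label_cost \<epsilon> (label_plan (gibbs_density (exp (- 1 / \<epsilon>)) (v \<epsilon>)))"
      if "0 < \<epsilon>" for \<epsilon>
      using that pot[OF that] by (rule gibbs_minimiser)
    show "((\<lambda>\<epsilon>. tv_dist (label_plan (gibbs_density (exp (- 1 / \<epsilon>)) (v \<epsilon>))) (label_plan limit_density))
        \<longlongrightarrow> 0) (at_right 0)"
      using pot by (rule gibbs_tv_tendsto)
    show "optimal_plan mu mu label_cost (label_plan limit_density)" by (rule limit_optimal)
    show "\<not> compact (measure_support (label_plan limit_density))" by (rule nc1)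
    show "\<not> compact off_rook_set" by (rule nc2)
    show "0 < ?I" by fact
    show "- ?I < Limsup (at_right 0)
      (\<lambda>\<epsilon>. ereal \<epsilon> * elog (measure (label_plan (gibbs_density (exp (- 1 / \<epsilon>)) (v \<epsilon>))) off_rook_set))"
      by (rule lim)
  qed
qed

end
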